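(* Fix $C_1,C_2$ with $2C_1+C_2>0$, and let $$b_1=\Big(-1+\frac{\sqrt6}{3}\Big)C_1^2+\Big(-\frac32+\frac{\sqrt6}{3}\Big)C_1C_2+\Big(-\frac18+\frac{\sqrt6}{12}\Big)C_2^2.$$ Consider the period function $\mathfrak L(C_1,C_2,C_3,b)$ as a function of $C_3$, for fixed $b$, on the set of $C_3\in(0,C_{3,crit})$ with $b_-(C_3)<b<b_+(C_3)$. Then: (i) if $b\in(-\frac12C_1^2-C_1C_2,\ b_1)$, $\mathfrak L$ is monotonically increasing in $C_3$; (ii) if $b\in(b_1,\ \frac18(C_2^2-4C_1C_2))$, $\mathfrak L$ has a single maximum point in $C_3$; (iii) if $b\in(\frac18(C_2^2-4C_1C_2),\ \frac16(C_1-C_2)^2)$, $\mathfrak L$ is monotonically decreasing in $C_3$.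
   Context: Let real constants $C_1,C_2$ be given with $2C_1+C_2>0$, and let $C_{3,crit}=\frac1{27}(2C_1+C_2)^3$. For $C_3\in(0,C_{3,crit})$, let $\phi_1<\phi_2<\phi_3$ be the roots of $2(\phi-C_1)^2(\phi+\frac{C_2}2)=C_3$; they satisfy $-\frac{C_2}{2}<\phi_1<\frac{C_1-C_2}{3}<\phi_2<C_1<\phi_3$. Let $U(\phi)=-\frac12\phi^2-\frac12C_2\phi-\frac12C_1C_2-\frac{C_3}{2(\phi-C_1)}$. Set $b_-(C_3)=U(\phi_2)$ and $b_+(C_3)=U(\phi_1)$. For $b\in(b_-(C_3),b_+(C_3))$, let $\phi_-<\phi_+$ be the two solutions of $U(\phi)=b$ with $\phi_1<\phi_-<\phi_2<\phi_+<C_1$. Define $$\mathfrak L(C_1,C_2,C_3,b)=2\int_{\phi_-}^{\phi_+}\frac{d\phi}{\sqrt{2(b-U(\phi))}}.$$ This is the period of the periodic orbit of $\frac12\dot\phi^2+U(\phi)=b$, which describes travelling waves of the DGH equation. *)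

theory Defs
  imports "HOL-Analysis.Analysis"
begin

definition C3crit :: "real \<Rightarrow> real \<Rightarrow> real" where
  "C3crit C1 C2 = (2*C1 + C2)^3 / 27"

definition Upot :: "real \<Rightarrow> real \<Rightarrow> real \<Rightarrow> real \<Rightarrow> real" where
  "Upot C1 C2 C3 \<phi> = - (1/2)*\<phi>^2 - (1/2)*C2*\<phi> - (1/2)*C1*C2 - C3 / (2*(\<phi> - C1))"

definition phi1 :: "real \<Rightarrow> real \<Rightarrow> real \<Rightarrow> real" where
  "phi1 C1 C2 C3 = (THE \<phi>. - C2/2 < \<phi> \<and> \<phi> < (C1 - C2)/3 \<and>
                             2*(\<phi> - C1)^2*(\<phi> + C2/2) = C3)"

definition phi2 :: "real \<Rightarrow> real \<Rightarrow> real \<Rightarrow> real" where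
  "phi2 C1 C2 C3 = (THE \<phi>. (C1 - C2)/3 < \<phi> \<and> \<phi> < C1 \<and>
                             2*(\<phi> - C1)^2*(\<phi> + C2/2) = C3)"

definition bminus :: "real \<Rightarrow> real \<Rightarrow> real \<Rightarrow> real" where
  "bminus C1 C2 C3 = Upot C1 C2 C3 (phi2 C1 C2 C3)"

definition bplus :: "real \<Rightarrow> real \<Rightarrow> real \<Rightarrow> real" where
  "bplus C1 C2 C3 = Upot C1 C2 C3 (phi1 C1 C2 C3)"

definition phi_minus :: "real \<Rightarrow> real \<Rightarrow> real \<Rightarrow> real \<Rightarrow> real" where
  "phi_minus C1 C2 C3 b = (THE \<phi>. phi1 C1 C2 C3 < \<phi> \<and> \<phi> < phi2 C1 C2 C3 \<and>
                                  Upot C1 C2 C3 \<phi> = b)"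

definition phi_plus :: "real \<Rightarrow> real \<Rightarrow> real \<Rightarrow> real \<Rightarrow> real" where
  "phi_plus C1 C2 C3 b = (THE \<phi>. phi2 C1 C2 C3 < \<phi> \<and> \<phi> < C1 \<and>
                                 Upot C1 C2 C3 \<phi> = b)"

text \<open>Period of the periodic orbit (integrand is integrable; endpoint values irrelevant).\<close>
definition period :: "real \<Rightarrow> real \<Rightarrow> real \<Rightarrow> real \<Rightarrow> real" where
  "period C1 C2 C3 b = 2 * integral {phi_minus C1 C2 C3 b .. phi_plus C1 C2 C3 b}
       (\<lambda>\<phi>. 1 / sqrt (2*(b - Upot C1 C2 C3 \<phi>)))"

definition admC3 :: "real \<Rightarrow> real \<Rightarrow> real \<Rightarrow> real set" where
  "admC3 C1 C2 b = {C3. 0 < C3 \<and> C3 < C3crit C1 C2 \<and>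
                        bminus C1 C2 C3 < b \<and> b < bplus C1 C2 C3}"

definition b1const :: "real \<Rightarrow> real \<Rightarrow> real" where
  "b1const C1 C2 = (-1 + sqrt 6/3)*C1^2 + (-3/2 + sqrt 6/3)*C1*C2 + (-1/8 + sqrt 6/12)*C2^2"

definition strict_decr_on :: "real set \<Rightarrow> (real \<Rightarrow> real) \<Rightarrow> bool" where
  "strict_decr_on S f \<longleftrightarrow> (\<forall>x\<in>S. \<forall>y\<in>S. x < y \<longrightarrow> f y < f x)"

end

theory Submission
  imports Defs
begin

text \<open>
  With \<open>x = C1 - \<phi>\<close>, \<open>k = 2 * C1 + C2\<close>, \<open>B = 2 * b + C1^2 + 2 * C1 * C2\<close> one has
  \<open>2 * (b - U \<phi>) = (x^3 - k * x^2 + B * x - C3) / x\<close>, so fixing \<open>b\<close> fixes the first two elementary symmetric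
  functions \<open>k\<close> and \<open>B\<close> of the roots \<open>r1 < r2 < r3\<close>, and \<open>C3\<close> is the third one. The midpoint
  \<open>s = (r1 + r2) / 2\<close> is an explicit parameter: \<open>C3 = h s\<close> is a polynomial that decreases in \<open>s\<close>, and
  \<open>x = s + sqrt (Q s) * sin \<theta>\<close> turns the period into an integral over a fixed interval.

  Modulo exact terms, the derivative of the period in \<open>C3\<close> is \<open>N / \<Delta>\<close>, with \<open>\<Delta> > 0\<close> the discriminant and \<open>N\<close> a
  combination of complete elliptic integrals \<open>K0\<close>, \<open>K1\<close> of the first and second kind. The Picard-Fuchs
  system for these yields an integrating factor: \<open>(h powr - c * N)'\<close> is \<open>K0 > 0\<close> times an explicit factor
  whose sign is that of \<open>R\<close>, an affine function of \<open>h\<close>. As \<open>N = 0\<close> at the centre \<open>r1 = r2\<close>, the sign of \<open>N\<close>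
  is governed by the position of the zero of \<open>R\<close>. It lies beyond the centre value of \<open>h\<close> in case (i), below
  all admissible values in case (iii), and in between in case (ii), where \<open>h powr - c * N\<close> tends to infinity
  as \<open>h\<close> tends to 0, so that \<open>N\<close> has exactly one zero.
\<close>

section \<open>Differentiation of the integrals\<close>

text \<open>Differentiation under the integral sign. The part \<open>ex\<close> of the derivative
  has the primitive \<open>E\<close> in \<theta>, whose end values agree, so only \<open>tgt\<close>
  survives integration.\<close>

lemma has_real_derivative_integral_modulo_exact:
  fixes f tgt E ex :: "real \<Rightarrow> real \<Rightarrow> real"
  assumes U: "open U" "convex U" "s0 \<in> U" and ab: "a \<le> b"
    and f: "\<And>s \<theta>. s \<in> U \<Longrightarrow> ((\<lambda>s. f s \<theta>) has_real_derivative tgt s \<theta> + ex s \<theta>) (at s)"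
    and E: "\<And>s \<theta>. s \<in> U \<Longrightarrow> ((\<lambda>\<theta>. E s \<theta>) has_real_derivative ex s \<theta>) (at \<theta>)"
    and E_ends: "\<And>s. s \<in> U \<Longrightarrow> E s a = E s b"
    and f_cont: "\<And>s. s \<in> U \<Longrightarrow> continuous_on {a..b} (f s)"
    and tgt_cont: "continuous_on (U \<times> {a..b}) (\<lambda>p. tgt (fst p) (snd p))"
    and ex_cont: "continuous_on (U \<times> {a..b}) (\<lambda>p. ex (fst p) (snd p))"
  shows "((\<lambda>s. integral {a..b} (f s)) has_real_derivative integral {a..b} (tgt s0)) (at s0)"
proof -
  have 1: "((\<lambda>s. integral (cbox a b) (f s)) has_field_derivative
      integral (cbox a b) (\<lambda>\<theta>. tgt s0 \<theta> + ex s0 \<theta>)) (at s0 within U)"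
  proof (rule leibniz_rule_field_derivative)
    show "((\<lambda>s. f s \<theta>) has_field_derivative tgt s \<theta> + ex s \<theta>) (at s within U)"
      if "s \<in> U" for s \<theta>
      using f[OF that] by (rule has_field_derivative_at_within)
    show "f s integrable_on cbox a b" if "s \<in> U" for s
      using f_cont[OF that] integrable_continuous_interval by simp
    show "continuous_on (U \<times> cbox a b) (\<lambda>(s, \<theta>). tgt s \<theta> + ex s \<theta>)"
      using continuous_on_add[OF tgt_cont ex_cont] by (simp add: case_prod_beta)
  qed (use U in auto)
  have slice: "continuous_on {a..b} (g s0)"
    if "continuous_on (U \<times> {a..b}) (\<lambda>p. g (fst p) (snd p))" for g :: "real \<Rightarrow> real \<Rightarrow> real"
  proof -
    have "continuous_on {a..b} ((\<lambda>p. g (fst p) (snd p)) \<circ> (\<lambda>\<theta>. (s0, \<theta>)))"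
      using U(3) by (intro continuous_on_compose continuous_intros continuous_on_subset[OF that]) auto
    then show ?thesis by (simp add: o_def)
  qed
  have "(E s0 has_vector_derivative ex s0 \<theta>) (at \<theta> within {a..b})" for \<theta>
    using E[OF U(3)] by (metis has_field_derivative_at_within has_real_derivative_iff_has_vector_derivative)
  then have "(ex s0 has_integral (E s0 b - E s0 a)) {a..b}"
    using ab by (intro fundamental_theorem_of_calculus)
  then have "ex s0 integrable_on {a..b}" and "integral {a..b} (ex s0) = 0"
    using E_ends[OF U(3)] by (auto simp: integral_unique integrable_on_def)
  then have "integral {a..b} (\<lambda>\<theta>. tgt s0 \<theta> + ex s0 \<theta>) = integral {a..b} (tgt s0)"
    using integral_add[OF integrable_continuous_interval[OF slice[OF tgt_cont]], of "ex s0"] by simp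
  then show ?thesis
    using 1 at_within_open[OF U(3,1)] by simp
qed

section \<open>Polynomial identities that split the derivatives into a reduced and an exact
  part\<close>

lemma period_exact_identity:
  fixes k s X Q B e P h :: real
  assumes "B = 2 * k * s - 3 * s^2 - Q" and "e = k - 2 * s - X" and "P = (k - 3 * s)^2 - Q"
    and "h = (s^2 - Q) * (k - 2 * s)"
  shows "4 * P * ((Q + (k - 3 * s) * (X - s)) * (2 * X * e - X * (k - 2 * s - 2 * X)) + 2 * Q * X^2)
    = -2 * ((B * (k^2 - 4 * B) + 3 * k * h) * X - 2 * h * (k^2 - 3 * B)) * e
      - 4 * (k^2 - 3 * B) * (k - 2 * s) * (-2 * (X - s) * X * e - (Q - (X - s)^2) * (k - 2 * s - 2 * X))"
  unfolding assms by algebra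

lemma wronskian_exact_identity:
  fixes k s X Q B e P h v A D :: real
  assumes "B = 2 * k * s - 3 * s^2 - Q" and "e = k - 2 * s - X" and "P = (k - 3 * s)^2 - Q"
    and "h = (s^2 - Q) * (k - 2 * s)"
    and "v = Q + (k - 3 * s) * (X - s)" and "A = B * (k^2 - 4 * B) + 3 * k * h" and "D = k^2 - 3 * B"
  shows "2 * (-6 * k * P * Q * X^2 * e + 4 * P * D * Q * X * e + 2 * h * D * v * e)
      - (A * X - 2 * h * D) * (v * (k - 2 * s - 2 * X) - 2 * Q * X)
    = -2 * P * (4 * k * X - (k^2 - 4 * B)) * Q * X * e
      + 2 * D * (k - 2 * s) * (k * s - B)
        * (-2 * (X - s) * X * e - 2 * (Q - (X - s)^2) * e - (Q - (X - s)^2) * (k - 2 * s - 2 * X))"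
  unfolding assms by algebra

text \<open>With \<open>G = g^3\<close>, the left side is the \<open>s\<close>-derivative of
  \<open>X * g\<close>, where \<open>v\<close> is that of \<open>X\<close>. On the right stand a
  multiple of the integrand of \<open>N\<close> and the \<theta>-derivative of a multiple of
  \<open>sqrt Q * cos \<theta> * g\<close>. Clearing denominators leaves
  \<open>period_exact_identity\<close>.\<close>

lemma period_derivative_split:
  fixes k s X Q B e P h A D g G v :: real
  assumes "B = 2 * k * s - 3 * s^2 - Q" and "e = k - 2 * s - X" and "P = (k - 3 * s)^2 - Q"
    and "h = (s^2 - Q) * (k - 2 * s)" and "A = B * (k^2 - 4 * B) + 3 * k * h" and "D = k^2 - 3 * B"
    and g: "g = G * (X * e)" and v: "v = (Q + (k - 3 * s) * (X - s)) / Q"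
    and nz: "Q \<noteq> 0" "P \<noteq> 0" "X \<noteq> 0"
  shows "v * g + X * (- (v * (k - 2 * s - 2 * X) - 2 * X) / 2 * G)
    = - (A * g - 2 * h * D * g / X) / (4 * Q * P)
      + - (D * (k - 2 * s) / (Q * P)) * (- (X - s) * g - (Q - (X - s)^2) * (k - 2 * s - 2 * X) / 2 * G)"
    (is "?l = ?r")
proof -
  define V where "V = Q + (k - 3 * s) * (X - s)"
  have "?l = G / (8 * P * Q) * (4 * P * (V * (2 * X * e - X * (k - 2 * s - 2 * X)) + 2 * Q * X^2))"
    using nz unfolding g v V_def[symmetric] by (simp add: field_simps power2_eq_square)
  also have "\<dots> = G / (8 * P * Q) * (-2 * (A * X - 2 * h * D) * e
      - 4 * D * (k - 2 * s) * (-2 * (X - s) * X * e - (Q - (X - s)^2) * (k - 2 * s - 2 * X)))"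
    unfolding V_def assms(5,6) by (simp only: period_exact_identity[OF assms(1-4)])
  also have "\<dots> = ?r"
  proof -
    define q where "q = Q - (X - s)^2"
    define r where "r = k - 2 * s - 2 * X"
    show ?thesis
      using nz unfolding g q_def[symmetric] r_def[symmetric] by (simp add: field_simps power2_eq_square)
  qed
  finally show ?thesis .
qed

text \<open>The analogous split for the \<open>s\<close>-derivative of the integrand of
  \<open>N\<close>; here the exact part comes from a multiple of
  \<open>sqrt Q * cos \<theta> * g / X\<close>.\<close>

lemma wronskian_derivative_split:
  fixes k s X Q B e P h A D g G v :: real
  assumes "B = 2 * k * s - 3 * s^2 - Q" and "e = k - 2 * s - X" and "P = (k - 3 * s)^2 - Q"
    and "h = (s^2 - Q) * (k - 2 * s)" and "A = B * (k^2 - 4 * B) + 3 * k * h" and "D = k^2 - 3 * B"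
    and g: "g = G * (X * e)" and v: "v = (Q + (k - 3 * s) * (X - s)) / Q"
    and nz: "Q \<noteq> 0" "P \<noteq> 0" "X \<noteq> 0"
  shows "- 6 * k * P * g + A * (- (v * (k - 2 * s - 2 * X) - 2 * X) / 2 * G)
      - 2 * D * (- 2 * P * (g / X) + h * ((- (v * (k - 2 * s - 2 * X) - 2 * X) / 2 * G) / X - v * g / X^2))
    = - 2 * P * (2 * k * g - (k^2 - 4 * B) / 2 * (g / X))
      + 2 * D * (k - 2 * s) * (k * s - B) / Q
        * (- (X - s) * g / X - (Q - (X - s)^2) * g / X^2
           - (Q - (X - s)^2) * (k - 2 * s - 2 * X) / 2 * G / X)"
    (is "?l = ?r")
proof -
  define V where "V = Q + (k - 3 * s) * (X - s)"
  define r where "r = k - 2 * s - 2 * X"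
  have "?l = G / (2 * Q * X) * (2 * (-6 * k * P * Q * X^2 * e + 4 * P * D * Q * X * e + 2 * h * D * V * e)
      - (A * X - 2 * h * D) * (V * r - 2 * Q * X))"
    using nz unfolding g v V_def[symmetric] r_def[symmetric]
    by (simp add: field_simps power2_eq_square)
  also have "\<dots> = G / (2 * Q * X) * (-2 * P * (4 * k * X - (k^2 - 4 * B)) * Q * X * e
      + 2 * D * (k - 2 * s) * (k * s - B)
        * (-2 * (X - s) * X * e - 2 * (Q - (X - s)^2) * e - (Q - (X - s)^2) * r))"
    unfolding r_def by (simp only: wronskian_exact_identity[OF assms(1-4) V_def assms(5,6)])
  also have "\<dots> = ?r"
  proof -
    define q where "q = Q - (X - s)^2"
    define T where "T = k^2 - 4 * B"
    define w where "w = k * s - B"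
    define z where "z = k - 2 * s"
    show ?thesis
      using nz unfolding g q_def[symmetric] r_def[symmetric] T_def[symmetric] w_def[symmetric]
      unfolding z_def[symmetric] by (simp add: field_simps power2_eq_square)
  qed
  finally show ?thesis .
qed

section \<open>The curve, its parameter and its complete integrals\<close>

locale period_curve =
  fixes k B :: real
  assumes k_pos: "0 < k" and B_pos: "0 < B" and B_less: "3 * B < k^2"
begin

text \<open>The roots of the cubic are \<open>s - sqrt (Q s)\<close>, \<open>s + sqrt (Q s)\<close> and \<open>k - 2 * s\<close>, their product is \<open>h s\<close>, and
  \<open>P s\<close> is the product of the distances of the third root to the first two. The set \<open>cdom\<close> also contains
  the centre, where the first two roots coincide.\<close>

definition Q :: "real \<Rightarrow> real" where "Q s = 2 * k * s - 3 * s^2 - B"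
definition P :: "real \<Rightarrow> real" where "P s = (k - 3 * s)^2 - Q s"
definition h :: "real \<Rightarrow> real" where "h s = (s^2 - Q s) * (k - 2 * s)"
text \<open>\<open>4 * D\<close> is the discriminant of the derivative of the cubic.
  \<open>T\<close> below is the discriminant of \<open>x^2 - k * x + B\<close>, the quadratic factor
  that is left when the product of the roots is 0.\<close>

definition D :: real where "D = k^2 - 3 * B"
definition T :: real where "T = k^2 - 4 * B"
definition A :: "real \<Rightarrow> real" where "A s = B * T + 3 * k * h s"

definition cdom :: "real set" where
  "cdom = {s. 3 * s < k \<and> 0 \<le> Q s \<and> Q s < s^2 \<and> 0 < P s}"
definition dom :: "real set" where "dom = {s\<in>cdom. 0 < Q s}"

definition X :: "real \<Rightarrow> real \<Rightarrow> real" where "X s \<theta> = s + sqrt (Q s) * sin \<theta>"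
definition g :: "real \<Rightarrow> real \<Rightarrow> real" where "g s \<theta> = 1 / sqrt (X s \<theta> * (k - 2 * s - X s \<theta>))"

abbreviation I :: "real set" where "I \<equiv> {- (pi/2)..pi/2}"

text \<open>On the curve \<open>y^2 = x * (x - r1) * (x - r2) * (x - r3)\<close> one has
  \<open>g d\<theta> = dx / y\<close>. Thus \<open>L\<close>, \<open>K0\<close> and
  \<open>K1\<close> integrate \<open>2 * x dx / y\<close>, \<open>dx / y\<close> and
  \<open>dx / (x * y)\<close>, which are of the third, first and second kind; the last because 0 is
  a branch point.\<close>

definition L :: "real \<Rightarrow> real" where "L s = 2 * integral I (\<lambda>\<theta>. X s \<theta> * g s \<theta>)"
definition K0 :: "real \<Rightarrow> real" where "K0 s = integral I (g s)"
definition K1 :: "real \<Rightarrow> real" where "K1 s = integral I (\<lambda>\<theta>. g s \<theta> / X s \<theta>)"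
definition N :: "real \<Rightarrow> real" where
  "N s = integral I (\<lambda>\<theta>. A s * g s \<theta> - 2 * D * (h s * (g s \<theta> / X s \<theta>)))"

lemma dom_subset: "dom \<subseteq> cdom"
  by (auto simp: dom_def)

lemma cdom_pos: "s \<in> cdom \<Longrightarrow> 0 < s"
proof -
  assume "s \<in> cdom"
  then have "0 < k * s" using B_pos zero_le_power2[of s] by (auto simp: cdom_def Q_def)
  then show "0 < s" using k_pos by (simp add: zero_less_mult_iff)
qed

lemma sqrt_Q_bounds:
  assumes "s \<in> cdom"
  shows "0 \<le> sqrt (Q s)" "sqrt (Q s) < s" "sqrt (Q s) < k - 3 * s"
proof -
  show "sqrt (Q s) < s" using assms cdom_pos[OF assms] by (intro real_less_lsqrt) (auto simp: cdom_def)
  show "sqrt (Q s) < k - 3 * s" using assms by (intro real_less_lsqrt) (auto simp: cdom_def P_def)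
qed (use assms in \<open>auto simp: cdom_def\<close>)

lemma X_bounds:
  assumes "s \<in> cdom"
  shows "0 < X s \<theta>" "0 < k - 2 * s - X s \<theta>"
proof -
  have "\<bar>sqrt (Q s) * sin \<theta>\<bar> \<le> sqrt (Q s)"
    using sqrt_Q_bounds(1)[OF assms] by (simp add: abs_mult mult_left_le)
  then show "0 < X s \<theta>" "0 < k - 2 * s - X s \<theta>"
    using sqrt_Q_bounds[OF assms] by (auto simp: X_def abs_le_iff)
qed

lemma g_pos: "s \<in> cdom \<Longrightarrow> 0 < g s \<theta>"
  using X_bounds by (simp add: g_def)

text \<open>Derivatives of \<open>g\<close> bring in \<open>g^3\<close>. Writing \<open>g\<close>
  itself as a multiple of \<open>g^3\<close> puts all terms over the same power, so that only
  polynomial identities in \<open>X\<close> remain.\<close>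

lemma g_cube:
  assumes "s \<in> cdom"
  shows "g s \<theta> = g s \<theta> ^ 3 * (X s \<theta> * (k - 2 * s - X s \<theta>))"
proof -
  have "(1 / sqrt w)^2 * w = 1" if "0 < w" for w :: real
    using that by (simp add: power_divide)
  then have "g s \<theta> ^ 2 * (X s \<theta> * (k - 2 * s - X s \<theta>)) = 1"
    unfolding g_def using X_bounds[OF assms] by simp
  then have "g s \<theta> * (g s \<theta> ^ 2 * (X s \<theta> * (k - 2 * s - X s \<theta>))) = g s \<theta>"
    by (simp only: mult_1_right)
  then show ?thesis by (simp only: power3_eq_cube power2_eq_square mult.assoc)
qed

lemma h_pos: "s \<in> cdom \<Longrightarrow> 0 < h s"
  unfolding h_def using cdom_pos[of s] by (intro mult_pos_pos) (auto simp: cdom_def)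

lemma continuous_X: "continuous_on S (\<lambda>p. X (fst p) (snd p))"
  unfolding X_def Q_def by (intro continuous_intros)

lemma continuous_g:
  assumes "S \<subseteq> cdom"
  shows "continuous_on (S \<times> V) (\<lambda>p. g (fst p) (snd p))"
proof -
  have "X s \<theta> * (k - 2 * s - X s \<theta>) \<noteq> 0" if "s \<in> S" for s \<theta>
    using X_bounds[of s \<theta>] that assms by auto
  then show ?thesis
    unfolding g_def by (intro continuous_intros continuous_X) (auto simp del: mult_eq_0_iff)
qed

lemma continuous_X_slice: "continuous_on V (X s)"
  unfolding X_def by (intro continuous_intros)

lemma continuous_g_slice:
  assumes "s \<in> cdom"
  shows "continuous_on V (g s)"
proof -
  have "X s \<theta> * (k - 2 * s - X s \<theta>) \<noteq> 0" for \<theta>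
    using X_bounds[of s \<theta>] assms by auto
  then show ?thesis
    unfolding g_def by (intro continuous_intros continuous_X_slice) (auto simp del: mult_eq_0_iff)
qed

section \<open>Derivatives of the ingredients in \<open>s\<close> and in \<theta>\<close>

lemma Q_deriv [derivative_intros]: "(Q has_real_derivative 2 * (k - 3 * s)) (at s)"
  unfolding Q_def by (auto intro!: derivative_eq_intros simp: algebra_simps)

lemma h_deriv [derivative_intros]: "(h has_real_derivative - 2 * P s) (at s)"
  unfolding h_def Q_def P_def
  by (auto intro!: derivative_eq_intros simp: algebra_simps power2_eq_square)

lemma A_deriv [derivative_intros]: "(A has_real_derivative - 6 * k * P s) (at s)"
  unfolding A_def by (auto intro!: derivative_eq_intros)

text \<open>This is the \<open>s\<close>-derivative of \<open>X\<close>, with the sine and the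
  square root expressed through \<open>X\<close> so that the result is rational.\<close>

definition v :: "real \<Rightarrow> real \<Rightarrow> real" where
  "v s \<theta> = (Q s + (k - 3 * s) * (X s \<theta> - s)) / Q s"

lemma X_deriv_s:
  assumes "s \<in> dom"
  shows "((\<lambda>s. X s \<theta>) has_real_derivative v s \<theta>) (at s)"
proof -
  have Q: "0 < Q s" using assms by (simp add: dom_def)
  have "((\<lambda>s. X s \<theta>) has_real_derivative 1 + (inverse (sqrt (Q s)) / 2 * (2 * (k - 3 * s))) * sin \<theta>) (at s)"
    unfolding X_def using Q
    by (auto intro!: derivative_eq_intros DERIV_chain2[OF DERIV_real_sqrt])
  moreover have "1 + (inverse (sqrt (Q s)) / 2 * (2 * (k - 3 * s))) * sin \<theta> = v s \<theta>"
  proof -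
    have "sqrt (Q s) * sqrt (Q s) = Q s" using Q by simp
    then have "inverse (sqrt (Q s)) = sqrt (Q s) / Q s" using Q by (simp add: field_simps)
    then show ?thesis using Q unfolding v_def X_def by (simp add: field_simps)
  qed
  ultimately show ?thesis by simp
qed

lemma inverse_sqrt_deriv:
  assumes "(f has_real_derivative f') (at x)" and "0 < f x"
  shows "((\<lambda>x. 1 / sqrt (f x)) has_real_derivative - f' / 2 * (1 / sqrt (f x)) ^ 3) (at x)"
proof -
  have "((\<lambda>x. 1 / sqrt (f x)) has_real_derivative - (inverse (sqrt (f x)) / 2 * f') / (sqrt (f x) * sqrt (f x))) (at x)"
    using assms by (auto intro!: derivative_eq_intros DERIV_chain2[OF DERIV_real_sqrt])
  then show ?thesis by (simp add: power3_eq_cube field_simps)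
qed

lemma g_deriv_s:
  assumes "s \<in> dom"
  shows "((\<lambda>s. g s \<theta>) has_real_derivative
    - (v s \<theta> * (k - 2 * s - 2 * X s \<theta>) - 2 * X s \<theta>) / 2 * g s \<theta> ^ 3) (at s)"
proof -
  have "((\<lambda>s. X s \<theta> * (k - 2 * s - X s \<theta>)) has_real_derivative
      v s \<theta> * (k - 2 * s - 2 * X s \<theta>) - 2 * X s \<theta>) (at s)"
    by (auto intro!: derivative_eq_intros X_deriv_s[OF assms] simp: algebra_simps)
  from inverse_sqrt_deriv[OF this] show ?thesis
    using X_bounds[of s \<theta>] assms dom_subset unfolding g_def by auto
qed

lemma X_deriv_\<theta>: "(X s has_real_derivative sqrt (Q s) * cos \<theta>) (at \<theta>)"
  unfolding X_def by (auto intro!: derivative_eq_intros)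

lemma g_deriv_\<theta>:
  assumes "s \<in> cdom"
  shows "(g s has_real_derivative - (sqrt (Q s) * cos \<theta> * (k - 2 * s - 2 * X s \<theta>)) / 2 * g s \<theta> ^ 3) (at \<theta>)"
proof -
  have "((\<lambda>\<theta>. X s \<theta> * (k - 2 * s - X s \<theta>)) has_real_derivative
      sqrt (Q s) * cos \<theta> * (k - 2 * s - 2 * X s \<theta>)) (at \<theta>)"
    by (auto intro!: derivative_eq_intros X_deriv_\<theta> simp: algebra_simps)
  from inverse_sqrt_deriv[OF this] show ?thesis
    using X_bounds[of s \<theta>] assms unfolding g_def by auto
qed

lemma sqrt_Q_cos:
  assumes "s \<in> cdom"
  shows "sqrt (Q s) * cos \<theta> * (sqrt (Q s) * cos \<theta>) = Q s - (X s \<theta> - s)^2"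
    and "sqrt (Q s) * sin \<theta> = X s \<theta> - s"
proof -
  have sqrt: "sqrt (Q s) ^ 2 = Q s" using assms by (simp add: cdom_def)
  have "sqrt (Q s) * cos \<theta> * (sqrt (Q s) * cos \<theta>) = sqrt (Q s) ^ 2 * cos \<theta> ^ 2"
    by (simp only: power2_eq_square mult_ac)
  also have "cos \<theta> ^ 2 = 1 - sin \<theta> ^ 2" by (rule cos_squared_eq)
  also have "sqrt (Q s) ^ 2 * (1 - sin \<theta> ^ 2) = Q s - (X s \<theta> - s)^2"
    by (simp only: X_def add_diff_cancel_left' power_mult_distrib sqrt right_diff_distrib mult_1_right)
  finally show "sqrt (Q s) * cos \<theta> * (sqrt (Q s) * cos \<theta>) = Q s - (X s \<theta> - s)^2" .
qed (simp add: X_def)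

text \<open>Both primitives contain \<open>cos \<theta>\<close> and hence vanish at the two ends of
  \<open>I\<close>, so their derivatives integrate to 0 there.\<close>

lemma exact_term_deriv:
  assumes s: "s \<in> cdom"
  shows "((\<lambda>\<theta>. c * (sqrt (Q s) * cos \<theta> * g s \<theta>)) has_real_derivative
      c * (- (X s \<theta> - s) * g s \<theta> - (Q s - (X s \<theta> - s)^2) * (k - 2 * s - 2 * X s \<theta>) / 2 * g s \<theta> ^ 3)) (at \<theta>)"
    and "((\<lambda>\<theta>. c * (sqrt (Q s) * cos \<theta> * g s \<theta> / X s \<theta>)) has_real_derivative
      c * (- (X s \<theta> - s) * g s \<theta> / X s \<theta> - (Q s - (X s \<theta> - s)^2) * g s \<theta> / X s \<theta> ^ 2
        - (Q s - (X s \<theta> - s)^2) * (k - 2 * s - 2 * X s \<theta>) / 2 * g s \<theta> ^ 3 / X s \<theta>)) (at \<theta>)"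
proof -
  have quotient: "c * (((- y * G1 + - (u * r) / 2 * G3 * u) * x - u * G1 * u) / (x * x))
      = c * (- y * G1 / x - u * u * G1 / x^2 - u * u * r / 2 * G3 / x)" if "x \<noteq> 0" for y G1 u r G3 x :: real
  proof -
    have "(z * x - w) / (x * x) = z / x - w / x^2" for z w :: real
      using that by (simp add: diff_divide_distrib power2_eq_square)
    then show ?thesis by (simp only:) (simp add: add_divide_distrib diff_divide_distrib mult_ac)
  qed
  define u where "u = sqrt (Q s) * cos \<theta>"
  define r where "r = k - 2 * s - 2 * X s \<theta>"
  have u: "((\<lambda>\<theta>. sqrt (Q s) * cos \<theta>) has_real_derivative - (X s \<theta> - s)) (at \<theta>)"
    unfolding X_def by (auto intro!: derivative_eq_intros)
  have uu: "Q s - (X s \<theta> - s)^2 = u * u"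
    unfolding u_def sqrt_Q_cos(1)[OF s, of \<theta>] ..
  note ug = DERIV_mult[OF u g_deriv_\<theta>[OF s, of \<theta>], folded u_def r_def]
  show "((\<lambda>\<theta>. c * (sqrt (Q s) * cos \<theta> * g s \<theta>)) has_real_derivative
      c * (- (X s \<theta> - s) * g s \<theta> - (Q s - (X s \<theta> - s)^2) * (k - 2 * s - 2 * X s \<theta>) / 2 * g s \<theta> ^ 3)) (at \<theta>)"
    unfolding uu r_def[symmetric] by (rule DERIV_cong[OF DERIV_cmult[OF ug]]) (simp add: algebra_simps)
  have "X s \<theta> \<noteq> 0" using X_bounds(1)[OF s, of \<theta>] by simp
  note ugX = DERIV_divide[OF ug X_deriv_\<theta>[of s \<theta>] this, folded u_def r_def]
  show "((\<lambda>\<theta>. c * (sqrt (Q s) * cos \<theta> * g s \<theta> / X s \<theta>)) has_real_derivative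
      c * (- (X s \<theta> - s) * g s \<theta> / X s \<theta> - (Q s - (X s \<theta> - s)^2) * g s \<theta> / X s \<theta> ^ 2
        - (Q s - (X s \<theta> - s)^2) * (k - 2 * s - 2 * X s \<theta>) / 2 * g s \<theta> ^ 3 / X s \<theta>)) (at \<theta>)"
    unfolding uu r_def[symmetric]
    by (rule DERIV_cong[OF DERIV_cmult[OF ugX]]) (rule quotient[OF \<open>X s \<theta> \<noteq> 0\<close>])
qed

text \<open>As long as \<open>3 * s < k\<close>, \<open>Q\<close> increases and \<open>P\<close>
  decreases. Only the product of the two lower roots, \<open>s^2 - Q s\<close>, needs a case
  distinction: it is a parabola in \<open>s\<close> with vertex at \<open>k / 4\<close>.\<close>

lemma cdom_between:
  assumes s: "s \<in> cdom" and t: "t \<in> cdom" and le: "s \<le> u" "u \<le> t"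
  shows "u \<in> cdom" "Q s \<le> Q u"
proof -
  have tk: "3 * t < k" and u: "3 * u < k" using t le by (auto simp: cdom_def)
  have "Q u - Q s = (u - s) * (2 * k - 3 * (u + s))"
    unfolding Q_def by algebra
  also have "\<dots> \<ge> 0" using le tk by simp
  finally show Q: "Q s \<le> Q u" by simp
  have Pdec: "P b \<le> P a" if "a \<le> b" "3 * b < k" for a b
  proof -
    have "P a - P b = (b - a) * (8 * k - 12 * (a + b))"
      unfolding Q_def P_def by algebra
    also have "\<dots> \<ge> 0" using that k_pos by (intro mult_nonneg_nonneg) auto
    finally show ?thesis by simp
  qed
  have "0 < u^2 - Q u"
  proof (cases "4 * t \<le> k")
    case True
    have "(u^2 - Q u) - (t^2 - Q t) = (t - u) * (2 * k - 4 * (u + t))"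
      unfolding Q_def by algebra
    also have "\<dots> \<ge> 0" using True le by simp
    finally show ?thesis using t by (simp add: cdom_def)
  next
    case False
    \<comment> \<open>At \<open>k / 4\<close> the functions \<open>P\<close> and
      \<open>s^2 - Q s\<close> share the value \<open>B - k^2 / 4\<close>, which is the minimum of
      the latter. Positivity of \<open>P t\<close> therefore makes the product of the lower roots
      positive everywhere.\<close>
    then have "P t \<le> P (k / 4)" using tk by (intro Pdec) auto
    then have "0 < B - k^2 / 4"
      using t by (simp add: cdom_def P_def Q_def power2_eq_square)
    moreover have "u^2 - Q u = (2 * u - k / 2)^2 + (B - k^2 / 4)"
      unfolding Q_def by (simp add: power2_eq_square algebra_simps)
    ultimately show ?thesis by (simp add: add_nonneg_pos)
  qed
  moreover have "P t \<le> P u" using le tk by (intro Pdec) auto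
  ultimately show "u \<in> cdom"
    using u s t Q by (auto simp: cdom_def)
qed

lemma dom_between: "s \<in> dom \<Longrightarrow> t \<in> dom \<Longrightarrow> s \<le> u \<Longrightarrow> u \<le> t \<Longrightarrow> u \<in> dom"
  using cdom_between[of s t u] by (force simp: dom_def)

lemma convex_dom: "convex dom"
  by (meson dom_between is_interval_1 is_interval_convex_1)

lemma open_dom: "open dom"
proof -
  have "dom = {s. 3 * s < k} \<inter> {s. 0 < Q s} \<inter> {s. Q s < s^2} \<inter> {s. 0 < P s}"
    by (auto simp: dom_def cdom_def)
  also have "open \<dots>"
    unfolding P_def Q_def by (intro open_Int open_Collect_less continuous_intros)
  finally show ?thesis .
qed

lemma dom_cdom: "s \<in> dom \<Longrightarrow> s \<in> cdom"
  by (simp add: dom_def)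

lemma dom_nonzero:
  assumes "s \<in> dom"
  shows "Q s \<noteq> 0" "P s \<noteq> 0" "X s \<theta> \<noteq> 0" "h s \<noteq> 0"
  using assms X_bounds(1)[OF dom_cdom[OF assms], of \<theta>] h_pos[OF dom_cdom[OF assms]]
  by (auto simp: dom_def cdom_def)

lemma continuous_coeffs [continuous_intros]:
  "continuous_on S (\<lambda>p. Q (fst p))" "continuous_on S (\<lambda>p. P (fst p))"
  "continuous_on S (\<lambda>p. h (fst p))" "continuous_on S (\<lambda>p. A (fst p))"
  unfolding A_def P_def h_def Q_def by (intro continuous_intros)+

lemma D_pos: "0 < D"
  using B_less by (simp add: D_def)

lemma integrable_basis:
  assumes "s \<in> cdom"
  shows "g s integrable_on I" "(\<lambda>\<theta>. g s \<theta> / X s \<theta>) integrable_on I"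
proof -
  have "\<forall>\<theta>\<in>I. X s \<theta> \<noteq> 0" using X_bounds(1)[OF assms] by (metis less_irrefl)
  then have "continuous_on I (\<lambda>\<theta>. g s \<theta> / X s \<theta>)"
    by (intro continuous_on_divide continuous_g_slice[OF assms] continuous_X_slice)
  then show "(\<lambda>\<theta>. g s \<theta> / X s \<theta>) integrable_on I" by (rule integrable_continuous_interval)
  show "g s integrable_on I"
    by (rule integrable_continuous_interval[OF continuous_g_slice[OF assms]])
qed

lemma integral_combination:
  assumes "s \<in> cdom"
  shows "integral I (\<lambda>\<theta>. a * g s \<theta> - b * (g s \<theta> / X s \<theta>)) = a * K0 s - b * K1 s"
  using integral_diff[OF integrable_on_mult_right[OF integrable_basis(1)[OF assms], of a]
      integrable_on_mult_right[OF integrable_basis(2)[OF assms], of b]]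
  by (simp only: integral_mult_right K0_def K1_def)

lemma N_eq:
  assumes "s \<in> cdom"
  shows "N s = A s * K0 s - 2 * D * h s * K1 s"
  unfolding N_def mult.assoc[symmetric, of "2 * D"]
  by (rule integral_combination[OF assms])

lemma coeff_identities:
  "B = 2 * k * s - 3 * s^2 - Q s" "A s = B * (k^2 - 4 * B) + 3 * k * h s"
  by (simp_all add: Q_def A_def T_def)

text \<open>Division by \<open>h' = - 2 * P\<close> turns this into
  \<open>dL/dh = N / (4 * Q * P^2)\<close>, where the denominator is the discriminant of the
  cubic.\<close>

lemma L_deriv:
  assumes s: "s \<in> dom"
  shows "(L has_real_derivative - N s / (2 * Q s * P s)) (at s)"
proof -
  define tgt where "tgt = (\<lambda>s \<theta>. - (A s * g s \<theta> - 2 * h s * D * g s \<theta> / X s \<theta>) / (4 * Q s * P s))"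
  define c where "c = (\<lambda>s. - (D * (k - 2 * s) / (Q s * P s)))"
  define ex where "ex = (\<lambda>s \<theta>. c s * (- (X s \<theta> - s) * g s \<theta>
      - (Q s - (X s \<theta> - s)^2) * (k - 2 * s - 2 * X s \<theta>) / 2 * g s \<theta> ^ 3))"
  have "((\<lambda>s. integral I (\<lambda>\<theta>. X s \<theta> * g s \<theta>)) has_real_derivative integral I (tgt s)) (at s)"
  proof (rule has_real_derivative_integral_modulo_exact[where U = dom and ex = ex
        and E = "\<lambda>s \<theta>. c s * (sqrt (Q s) * cos \<theta> * g s \<theta>)"])
    show "((\<lambda>s. X s \<theta> * g s \<theta>) has_real_derivative tgt s \<theta> + ex s \<theta>) (at s)"
      if s: "s \<in> dom" for s \<theta>
      using DERIV_mult[OF X_deriv_s[OF s, of \<theta>] g_deriv_s[OF s, of \<theta>]]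
        period_derivative_split[OF coeff_identities(1) refl P_def h_def coeff_identities(2) D_def
          g_cube[OF dom_cdom[OF s], of \<theta>] v_def dom_nonzero(1,2,3)[OF s]]
      unfolding tgt_def ex_def c_def by (simp add: mult.commute)
    show "((\<lambda>\<theta>. c s * (sqrt (Q s) * cos \<theta> * g s \<theta>)) has_real_derivative ex s \<theta>) (at \<theta>)"
      if "s \<in> dom" for s \<theta>
      unfolding ex_def by (rule exact_term_deriv(1)[OF dom_cdom[OF that]])
    show "continuous_on I (\<lambda>\<theta>. X s \<theta> * g s \<theta>)" if "s \<in> dom" for s
      by (intro continuous_on_mult continuous_X_slice continuous_g_slice dom_cdom that)
    show "continuous_on (dom \<times> I) (\<lambda>p. tgt (fst p) (snd p))"
      unfolding tgt_def
      by (intro continuous_intros continuous_X continuous_g dom_subset) (use dom_nonzero in auto)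
    show "continuous_on (dom \<times> I) (\<lambda>p. ex (fst p) (snd p))"
      unfolding ex_def c_def
      by (intro continuous_intros continuous_X continuous_g dom_subset) (use dom_nonzero in auto)
  qed (use s open_dom convex_dom in auto)
  moreover have "integral I (tgt s) = - N s / (4 * Q s * P s)"
  proof -
    have "tgt s = (\<lambda>\<theta>. (- 1 / (4 * Q s * P s)) * (A s * g s \<theta> - 2 * D * (h s * (g s \<theta> / X s \<theta>))))"
    proof
      have eq: "A s * g s \<theta> - 2 * h s * D * g s \<theta> / X s \<theta> = A s * g s \<theta> - 2 * D * (h s * (g s \<theta> / X s \<theta>))" for \<theta>
        by (simp add: mult_ac)
      show "tgt s \<theta> = (- 1 / (4 * Q s * P s)) * (A s * g s \<theta> - 2 * D * (h s * (g s \<theta> / X s \<theta>)))" for \<theta>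
        unfolding tgt_def eq by (simp only: times_divide_eq_left mult_minus_left mult_1_left)
    qed
    then show ?thesis by (simp add: N_def)
  qed
  ultimately have "((\<lambda>s. 2 * integral I (\<lambda>\<theta>. X s \<theta> * g s \<theta>)) has_real_derivative
      2 * (- N s / (4 * Q s * P s))) (at s)"
    by (intro DERIV_cmult) simp
  then show ?thesis
    unfolding L_def[abs_def] by (rule DERIV_cong) simp
qed

text \<open>This is the Picard-Fuchs relation \<open>dN/dh = 2 * k * K0 - T / 2 * K1\<close>. The
  factor \<open>1 / Q\<close>, singular at the centre, occurs only in the exact part.\<close>

lemma N_deriv:
  assumes s: "s \<in> dom"
  shows "(N has_real_derivative - 2 * P s * (2 * k * K0 s - T / 2 * K1 s)) (at s)"
proof -
  define tgt where "tgt = (\<lambda>s \<theta>. - 2 * P s * (2 * k * g s \<theta> - (k^2 - 4 * B) / 2 * (g s \<theta> / X s \<theta>)))"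
  define c where "c = (\<lambda>s. 2 * D * (k - 2 * s) * (k * s - B) / Q s)"
  define ex where "ex = (\<lambda>s \<theta>. c s * (- (X s \<theta> - s) * g s \<theta> / X s \<theta>
      - (Q s - (X s \<theta> - s)^2) * g s \<theta> / X s \<theta> ^ 2
      - (Q s - (X s \<theta> - s)^2) * (k - 2 * s - 2 * X s \<theta>) / 2 * g s \<theta> ^ 3 / X s \<theta>))"
  have "((\<lambda>s. integral I (\<lambda>\<theta>. A s * g s \<theta> - 2 * D * (h s * (g s \<theta> / X s \<theta>))))
      has_real_derivative integral I (tgt s)) (at s)"
  proof (rule has_real_derivative_integral_modulo_exact[where U = dom and ex = ex
        and E = "\<lambda>s \<theta>. c s * (sqrt (Q s) * cos \<theta> * g s \<theta> / X s \<theta>)"])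
    show "((\<lambda>s. A s * g s \<theta> - 2 * D * (h s * (g s \<theta> / X s \<theta>))) has_real_derivative tgt s \<theta> + ex s \<theta>) (at s)"
      if s: "s \<in> dom" for s \<theta>
    proof -
      define g' where "g' = - (v s \<theta> * (k - 2 * s - 2 * X s \<theta>) - 2 * X s \<theta>) / 2 * g s \<theta> ^ 3"
      note g' = g_deriv_s[OF s, of \<theta>, folded g'_def]
      have "((\<lambda>s. g s \<theta> / X s \<theta>) has_real_derivative g' / X s \<theta> - v s \<theta> * g s \<theta> / X s \<theta> ^ 2) (at s)"
        by (rule DERIV_cong[OF DERIV_divide[OF g' X_deriv_s[OF s] dom_nonzero(3)[OF s]]])
          (use dom_nonzero(3)[OF s] in \<open>simp add: diff_divide_distrib power2_eq_square mult.commute\<close>)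
      from DERIV_diff[OF DERIV_mult[OF A_deriv g'] DERIV_cmult[OF DERIV_mult[OF h_deriv this], of "2 * D"]]
      show ?thesis
      proof (rule DERIV_cong)
        have "- 6 * k * P s * g s \<theta> + A s * g'
            - 2 * D * (- 2 * P s * (g s \<theta> / X s \<theta>) + h s * (g' / X s \<theta> - v s \<theta> * g s \<theta> / X s \<theta> ^ 2))
            = tgt s \<theta> + ex s \<theta>"
          unfolding tgt_def ex_def c_def g'_def
          by (rule wronskian_derivative_split[OF coeff_identities(1) refl P_def h_def coeff_identities(2) D_def
              g_cube[OF dom_cdom[OF s], of \<theta>] v_def dom_nonzero(1,2,3)[OF s]])
        then show "- 6 * k * P s * g s \<theta> + g' * A s - 2 * D *
            (- 2 * P s * (g s \<theta> / X s \<theta>) + (g' / X s \<theta> - v s \<theta> * g s \<theta> / X s \<theta> ^ 2) * h s)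
            = tgt s \<theta> + ex s \<theta>"
          by (simp only: mult.commute)
      qed
    qed
    show "((\<lambda>\<theta>. c s * (sqrt (Q s) * cos \<theta> * g s \<theta> / X s \<theta>)) has_real_derivative ex s \<theta>) (at \<theta>)"
      if "s \<in> dom" for s \<theta>
      unfolding ex_def by (rule exact_term_deriv(2)[OF dom_cdom[OF that]])
    show "continuous_on I (\<lambda>\<theta>. A s * g s \<theta> - 2 * D * (h s * (g s \<theta> / X s \<theta>)))" if "s \<in> dom" for s
      by (intro continuous_intros continuous_X_slice continuous_g_slice dom_cdom that) (use dom_nonzero that in auto)
    show "continuous_on (dom \<times> I) (\<lambda>p. tgt (fst p) (snd p))"
      unfolding tgt_def
      by (intro continuous_intros continuous_X continuous_g dom_subset) (use dom_nonzero in auto)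
    show "continuous_on (dom \<times> I) (\<lambda>p. ex (fst p) (snd p))"
      unfolding ex_def c_def
      by (intro continuous_intros continuous_X continuous_g dom_subset) (use dom_nonzero in auto)
  qed (use s open_dom convex_dom in auto)
  moreover have "integral I (tgt s) = - 2 * P s * (2 * k * K0 s - T / 2 * K1 s)"
    unfolding tgt_def T_def
    by (simp only: integral_mult_right integral_combination[OF dom_cdom[OF s]])
  ultimately show ?thesis by (simp add: N_def[abs_def])
qed

section \<open>Sign of the derivative of the period\<close>

text \<open>With \<open>c = T / (4 * D)\<close> one has
  \<open>4 * D * (c * N - h * dN/dh) = R * K0\<close>. This \<open>c\<close> is the value for which
  the \<open>K1\<close> terms, \<open>- 2 * D * h * K1\<close> in \<open>N\<close> and
  \<open>- T / 2 * h * K1\<close> in \<open>h * dN/dh\<close>, cancel; it gives the exponent in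
  \<nu>.\<close>

definition R :: "real \<Rightarrow> real" where "R s = B * T^2 - k * (5 * k^2 - 12 * B) * h s"
definition \<nu> :: "real \<Rightarrow> real" where "\<nu> s = h s powr - (T / (4 * D)) * N s"
text \<open>The smaller zero of \<open>Q\<close>, that is, the centre.\<close>

definition m :: real where "m = (k - sqrt D) / 3"

text \<open>The bound follows from \<open>x * (k - 2 * s - x) \<le> (k / 2)^2\<close> and the length
  \<open>pi\<close> of \<open>I\<close>. Being uniform in \<open>s\<close>, it also serves near the
  end where \<open>h\<close> tends to 0.\<close>

lemma K0_ge:
  assumes "s \<in> cdom"
  shows "2 * pi / k \<le> K0 s"
proof -
  have "2 / k \<le> g s \<theta>" for \<theta>
  proof -
    define x where "x = X s \<theta>"
    have x: "0 < x" "0 < k - 2 * s - x" using X_bounds[OF assms] by (auto simp: x_def)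
    have "x * (k - 2 * s - x) \<le> x * (k - x)"
      using x cdom_pos[OF assms] by (intro mult_left_mono) auto
    also have "\<dots> = (k / 2)^2 - (x - k / 2)^2" by (simp add: power2_eq_square algebra_simps)
    also have "\<dots> \<le> (k / 2)^2" by simp
    finally have "sqrt (x * (k - 2 * s - x)) \<le> k / 2"
      using k_pos by (intro real_le_lsqrt) auto
    moreover have "0 < sqrt (x * (k - 2 * s - x))" using x by simp
    ultimately have "1 / (k / 2) \<le> 1 / sqrt (x * (k - 2 * s - x))" by (intro divide_left_mono mult_pos_pos) (use k_pos in auto)
    then show ?thesis by (simp add: g_def x_def)
  qed
  then have "integral I (\<lambda>_. 2 / k) \<le> integral I (g s)"
    using integrable_basis(1)[OF assms] by (intro integral_le) auto
  then show ?thesis by (simp add: K0_def mult.commute)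
qed

lemma K0_pos: "s \<in> cdom \<Longrightarrow> 0 < K0 s"
  using K0_ge[of s] k_pos pi_gt_zero by (smt (verit) divide_pos_pos)

section \<open>The centre and the integrating factor\<close>

lemma m_bounds: "0 < m" "3 * m < k" "Q m = 0"
proof -
  have "0 < sqrt D" using D_pos by simp
  moreover have "sqrt D < k" using k_pos B_pos by (intro real_less_lsqrt) (auto simp: D_def)
  ultimately show "0 < m" "3 * m < k" by (auto simp: m_def)
  have "k - 3 * m = sqrt D" by (simp add: m_def diff_divide_distrib)
  then have "(k - 3 * m)^2 = k^2 - 3 * B" using D_pos by (simp add: D_def)
  then show "Q m = 0" unfolding Q_def by (simp add: power2_eq_square algebra_simps)
qed

lemma m_cdom: "m \<in> cdom"
  using m_bounds by (simp add: cdom_def P_def)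

lemma B_m: "B = 2 * k * m - 3 * m^2"
  using m_bounds(3) by (simp add: Q_def)

lemma h_m: "h m = m^2 * (k - 2 * m)"
  by (simp add: h_def m_bounds)

lemma Q_pos_iff:
  assumes "3 * s < k"
  shows "0 < Q s \<longleftrightarrow> m < s"
proof -
  have "Q s = (s - m) * (2 * k - 3 * (s + m))"
    using B_m unfolding Q_def by algebra
  moreover have "0 < 2 * k - 3 * (s + m)" using assms m_bounds by simp
  ultimately show ?thesis by (simp add: zero_less_mult_iff)
qed

lemma dom_iff: "s \<in> dom \<longleftrightarrow> s \<in> cdom \<and> m < s"
  using Q_pos_iff[of s] by (auto simp: dom_def cdom_def)

lemma m_to_dom:
  assumes "t \<in> dom" "m \<le> s" "s \<le> t"
  shows "s \<in> cdom" "m < s \<Longrightarrow> s \<in> dom"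
  using cdom_between(1)[OF m_cdom dom_cdom[OF assms(1)] assms(2,3)] by (auto simp: dom_iff)

lemma N_m: "N m = 0"
proof -
  have "K1 m = K0 m / m" by (simp add: K1_def K0_def X_def m_bounds)
  then have "N m = K0 m * (A m - 2 * D * h m / m)"
    by (simp add: N_eq[OF m_cdom] algebra_simps)
  also have "A m - 2 * D * h m / m = A m - 2 * D * (m * (k - 2 * m))"
    using m_bounds(1) by (simp add: h_m power2_eq_square)
  also have "\<dots> = 0"
    unfolding A_def T_def D_def h_m using B_m by algebra
  finally show ?thesis by simp
qed

lemma continuous_N: "continuous_on cdom N"
proof -
  have "continuous_on (cdom \<times> cbox (- (pi/2)) (pi/2))
      (\<lambda>p. A (fst p) * g (fst p) (snd p) - 2 * D * (h (fst p) * (g (fst p) (snd p) / X (fst p) (snd p))))"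
    by (intro continuous_intros continuous_X continuous_g order_refl)
      (metis X_bounds(1) less_irrefl mem_Times_iff)
  then have "continuous_on cdom (\<lambda>s. integral (cbox (- (pi/2)) (pi/2))
      (\<lambda>\<theta>. A s * g s \<theta> - 2 * D * (h s * (g s \<theta> / X s \<theta>))))"
    by (intro integral_continuous_on_param) (simp add: case_prod_beta)
  then show ?thesis by (simp add: N_def[abs_def])
qed

lemma continuous_\<nu>: "continuous_on cdom \<nu>"
proof -
  have "continuous_on cdom h" by (meson DERIV_continuous continuous_at_imp_continuous_on h_deriv)
  then show ?thesis
    unfolding \<nu>_def using h_pos by (intro continuous_intros continuous_N) force+
qed

lemma \<nu>_sign:
  assumes "s \<in> cdom"
  shows "0 < \<nu> s \<longleftrightarrow> 0 < N s" "\<nu> s < 0 \<longleftrightarrow> N s < 0"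
  using h_pos[OF assms] by (auto simp: \<nu>_def zero_less_mult_iff mult_less_0_iff)

lemma \<nu>_m: "\<nu> m = 0"
  by (simp add: \<nu>_def N_m)

lemma \<nu>_deriv:
  assumes s: "s \<in> dom"
  shows "(\<nu> has_real_derivative P s * h s powr (- (T / (4 * D)) - 1) * R s * K0 s / (2 * D)) (at s)"
proof -
  have h: "0 < h s" by (rule h_pos[OF dom_cdom[OF s]])
  define c where "c = T / (4 * D)"
  define y where "y = h s powr (- c - 1)"
  have y: "h s powr - c = y * h s"
    using h by (simp add: y_def powr_diff)
  have "((\<lambda>s. h s powr - c * N s) has_real_derivative
      (- c * y * (- 2 * P s)) * N s + - 2 * P s * (2 * k * K0 s - T / 2 * K1 s) * h s powr - c) (at s)"
    unfolding y_def
    by (intro DERIV_mult N_deriv s DERIV_chain2[OF has_real_derivative_powr[OF h] h_deriv])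
  moreover have "(- c * y * (- 2 * P s)) * N s + - 2 * P s * (2 * k * K0 s - T / 2 * K1 s) * h s powr - c
      = P s * y * R s * K0 s / (2 * D)"
  proof -
    have "c * N s - (2 * k * K0 s - T / 2 * K1 s) * h s
        = (T * A s - 8 * k * D * h s) * K0 s / (4 * D)"
      using D_pos by (simp add: c_def N_eq[OF dom_cdom[OF s]] field_simps)
    also have "T * A s - 8 * k * D * h s = R s"
      unfolding A_def R_def D_def T_def by algebra
    finally have "2 * P s * y * (c * N s - (2 * k * K0 s - T / 2 * K1 s) * h s)
        = P s * y * R s * K0 s / (2 * D)" by simp
    then show ?thesis unfolding y by (simp add: algebra_simps)
  qed
  ultimately show ?thesis
    unfolding \<nu>_def[abs_def] y_def c_def by simp
qed

text \<open>The left end \<open>a\<close> may be the centre \<open>m\<close>, where continuity of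
  \<nu> replaces the derivative formula. Inside \<open>dom\<close> all factors of the derivative
  other than \<open>R\<close> are positive.\<close>

lemma \<nu>_less:
  assumes "b \<in> dom" "m \<le> a" "a < b"
  shows "(\<And>u. a < u \<Longrightarrow> u < b \<Longrightarrow> 0 < R u) \<Longrightarrow> \<nu> a < \<nu> b"
    and "(\<And>u. a < u \<Longrightarrow> u < b \<Longrightarrow> R u < 0) \<Longrightarrow> \<nu> b < \<nu> a"
proof -
  have cont: "continuous_on {a..b} \<nu>"
    using m_to_dom(1)[OF assms(1)] assms(2) by (intro continuous_on_subset[OF continuous_\<nu>]) auto
  have dom: "u \<in> dom" if "a < u" "u < b" for u
    using m_to_dom(2)[OF assms(1)] assms(2) that by auto
  have pos: "0 < P u * h u powr (- (T / (4 * D)) - 1) * K0 u / (2 * D)" if "u \<in> dom" for u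
    using that h_pos[of u] K0_pos[of u] D_pos dom_cdom[OF that] by (auto simp: cdom_def)
  show "\<nu> a < \<nu> b" if "\<And>u. a < u \<Longrightarrow> u < b \<Longrightarrow> 0 < R u"
  proof (rule DERIV_pos_imp_increasing_open[OF assms(3) _ cont])
    fix u assume u: "a < u" "u < b"
    then have "0 < R u * (P u * h u powr (- (T / (4 * D)) - 1) * K0 u / (2 * D))"
      using that[OF u] pos[OF dom[OF u]] by (intro mult_pos_pos)
    then show "\<exists>y. (\<nu> has_real_derivative y) (at u) \<and> 0 < y"
      using \<nu>_deriv[OF dom[OF u]] by (auto simp: mult_ac)
  qed
  show "\<nu> b < \<nu> a" if "\<And>u. a < u \<Longrightarrow> u < b \<Longrightarrow> R u < 0"
  proof (rule DERIV_neg_imp_decreasing_open[OF assms(3) _ cont])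
    fix u assume u: "a < u" "u < b"
    then have "R u * (P u * h u powr (- (T / (4 * D)) - 1) * K0 u / (2 * D)) < 0"
      using that[OF u] pos[OF dom[OF u]] by (intro mult_neg_pos)
    then show "\<exists>y. (\<nu> has_real_derivative y) (at u) \<and> y < 0"
      using \<nu>_deriv[OF dom[OF u]] by (auto simp: mult_ac)
  qed
qed

section \<open>The position of the zero of \<open>R\<close> and the two monotone cases\<close>

lemma h_less:
  assumes "a \<in> cdom" "b \<in> cdom" "a < b"
  shows "h b < h a"
proof (rule DERIV_neg_imp_decreasing[OF assms(3)])
  fix u assume "a \<le> u" "u \<le> b"
  then have "0 < P u" using cdom_between(1)[OF assms(1,2)] by (simp add: cdom_def)
  then show "\<exists>y. (h has_real_derivative y) (at u) \<and> y < 0"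
    using h_deriv[of u] by (intro exI[of _ "- 2 * P u"]) auto
qed

lemma h_less_iff: "a \<in> dom \<Longrightarrow> b \<in> dom \<Longrightarrow> h a < h b \<longleftrightarrow> b < a"
  using h_less[of a b] h_less[of b a] dom_cdom by (cases a b rule: linorder_cases) auto

lemma h_le_iff: "a \<in> dom \<Longrightarrow> b \<in> dom \<Longrightarrow> h a \<le> h b \<longleftrightarrow> b \<le> a"
  using h_less_iff[of b a] by (simp flip: not_less)

lemma F_pos: "0 < 5 * k^2 - 12 * B"
  using B_less B_pos by simp

text \<open>\<open>R\<close> is affine in \<open>h\<close> with negative slope, by
  \<open>F_pos\<close>, and \<open>h\<close> decreases in \<open>s\<close>.\<close>

lemma R_less:
  assumes "a \<in> cdom" "b \<in> cdom" "a < b"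
  shows "R a < R b"
  using h_less[OF assms] k_pos F_pos by (simp add: R_def)

lemma R_m: "R m = 2 * m * (k - 2 * m) * (k - 3 * m)^2 * (k^2 - 12 * k * m + 12 * m^2)"
  unfolding R_def T_def h_m using B_m by algebra

text \<open>The quartic form in \<open>k\<close> and \<open>B\<close> is quadratic in
  \<open>B / k^2\<close>; its positive zero is the threshold \<open>b1const\<close>. In terms of
  \<open>m\<close> it is the sign-carrying factor of \<open>R m\<close> times a negative
  quantity.\<close>

lemma R_m_sgn: "sgn (R m) = - sgn (48 * B^2 + 24 * B * k^2 - 5 * k^4)"
proof -
  have "48 * b^2 + 24 * b * k^2 - 5 * k^4 = (k^2 - 12 * k * x + 12 * x^2) * (36 * x^2 - 12 * k * x - 5 * k^2)"
    if "b = 2 * k * x - 3 * x^2" for b x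
    unfolding that by algebra
  note this[OF B_m]
  moreover have "36 * m^2 - 12 * k * m - 5 * k^2 < 0"
  proof -
    have "36 * m^2 - 12 * k * m = 12 * m * (3 * m - k)" by algebra
    also have "\<dots> < 0" using m_bounds by (intro mult_pos_neg) auto
    finally show ?thesis using zero_le_power2[of k] by linarith
  qed
  moreover have "sgn (2 * m * (k - 2 * m) * (k - 3 * m)^2) = 1"
    using m_bounds by (intro sgn_pos) simp
  ultimately show ?thesis
    unfolding R_m sgn_mult[of "2 * m * (k - 2 * m) * (k - 3 * m)^2"] by (simp add: sgn_mult)
qed

lemma L_less:
  assumes "a \<in> dom" "b \<in> dom" "a < b"
  shows "(\<And>u. a < u \<Longrightarrow> u < b \<Longrightarrow> 0 < N u) \<Longrightarrow> L b < L a"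
    and "(\<And>u. a < u \<Longrightarrow> u < b \<Longrightarrow> N u < 0) \<Longrightarrow> L a < L b"
proof -
  have dom: "u \<in> dom" if "a \<le> u" "u \<le> b" for u
    using dom_between assms that by blast
  have cont: "continuous_on {a..b} L"
    by (meson DERIV_continuous continuous_at_imp_continuous_on L_deriv dom atLeastAtMost_iff)
  have pos: "0 < 2 * Q u * P u" if "u \<in> dom" for u
    using that by (simp add: dom_def cdom_def)
  show "L b < L a" if "\<And>u. a < u \<Longrightarrow> u < b \<Longrightarrow> 0 < N u"
  proof (rule DERIV_neg_imp_decreasing_open[OF assms(3) _ cont])
    fix u assume u: "a < u" "u < b"
    then show "\<exists>y. (L has_real_derivative y) (at u) \<and> y < 0"
      using L_deriv[OF dom, of u] pos[OF dom, of u] that[OF u] by (auto simp del: mult_pos_pos intro!: exI divide_pos_pos)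
  qed
  show "L a < L b" if "\<And>u. a < u \<Longrightarrow> u < b \<Longrightarrow> N u < 0"
  proof (rule DERIV_pos_imp_increasing_open[OF assms(3) _ cont])
    fix u assume u: "a < u" "u < b"
    then show "\<exists>y. (L has_real_derivative y) (at u) \<and> 0 < y"
      using L_deriv[OF dom, of u] pos[OF dom, of u] that[OF u] by (auto simp del: mult_pos_pos intro!: exI divide_neg_pos)
  qed
qed

text \<open>Here \<nu> increases from its value 0 at the centre, so \<open>N\<close> is positive and
  the derivative of \<open>L\<close> in \<open>s\<close> is negative.\<close>

lemma L_decreasing_of_R_pos:
  assumes "\<And>s. s \<in> dom \<Longrightarrow> 0 < R s" "a \<in> dom" "b \<in> dom" "a < b"
  shows "L b < L a"
proof (rule L_less(1)[OF assms(2-4)])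
  fix u assume "a < u" "u < b"
  then have u: "u \<in> dom" using dom_between assms(2,3) by (meson less_imp_le)
  then have "\<nu> m < \<nu> u"
    using m_to_dom(2)[OF u] assms(1) by (intro \<nu>_less(1)) (auto simp: dom_iff)
  then show "0 < N u"
    using \<nu>_sign[OF dom_cdom[OF u]] by (simp add: \<nu>_m)
qed

lemma L_increasing_of_R_neg:
  assumes "\<And>s. s \<in> dom \<Longrightarrow> R s < 0" "a \<in> dom" "b \<in> dom" "a < b"
  shows "L a < L b"
proof (rule L_less(2)[OF assms(2-4)])
  fix u assume "a < u" "u < b"
  then have u: "u \<in> dom" using dom_between assms(2,3) by (meson less_imp_le)
  then have "\<nu> u < \<nu> m"
    using m_to_dom(2)[OF u] assms(1) by (intro \<nu>_less(2)) (auto simp: dom_iff)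
  then show "N u < 0"
    using \<nu>_sign[OF dom_cdom[OF u]] by (simp add: \<nu>_m)
qed

text \<open>The hypothesis says that \<open>R\<close> is positive at the centre, and
  \<open>R\<close> increases in \<open>s\<close>. This is case (i), as \<open>C3 = h s\<close>
  decreases in \<open>s\<close>.\<close>

lemma L_decreasing:
  assumes "48 * B^2 + 24 * B * k^2 - 5 * k^4 < 0" "a \<in> dom" "b \<in> dom" "a < b"
  shows "L b < L a"
proof (rule L_decreasing_of_R_pos[OF _ assms(2-4)])
  fix s assume s: "s \<in> dom"
  have "sgn (R m) = 1" using R_m_sgn assms(1) by simp
  then have "0 < R m" by (simp add: sgn_1_pos)
  also have "R m < R s" using s R_less[OF m_cdom] by (simp add: dom_iff)
  finally show "0 < R s" .
qed

text \<open>Both sides are the discriminant of the cubic: \<open>4 * Q\<close> is the squared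
  distance of the first two roots, and \<open>P\<close> the product of their distances to the
  third.\<close>

lemma discriminant_eq: "4 * Q s * P s^2 = B^2 * T - 4 * k^3 * h s + 18 * k * B * h s - 27 * h s^2"
  unfolding T_def h_def P_def Q_def by algebra

text \<open>If \<open>R s \<ge> 0\<close>, then \<open>h s\<close> lies left of the zero \<open>h0\<close> of \<open>R\<close> (as a function of \<open>h\<close>), which lies left
  of the vertex of the concave discriminant; but the discriminant is negative at \<open>h0\<close>.\<close>
lemma L_increasing:
  assumes "k^2 < 4 * B" "a \<in> dom" "b \<in> dom" "a < b"
  shows "L a < L b"
proof (rule L_increasing_of_R_neg[OF _ assms(2-4)])
  fix s assume s: "s \<in> dom"
  define F where "F = 5 * k^2 - 12 * B"
  define h0 where "h0 = B * T^2 / (k * F)"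
  have F: "0 < F" using F_pos by (simp add: F_def)
  have kF: "0 < k * F" using F k_pos by simp
  have T: "T < 0" using assms by (simp add: T_def)
  show "R s < 0"
  proof (rule ccontr)
    assume "\<not> R s < 0"
    then have le: "h s \<le> h0"
      using kF unfolding R_def h0_def F_def[symmetric] by (simp add: pos_le_divide_eq mult_ac)
    \<comment> \<open>The vertex of the discriminant, as a quadratic in \<open>h\<close>, is at
      \<open>k * (9 * B - 2 * k^2) / 27\<close>.\<close>
    have vertex: "27 * h0 < k * (9 * B - 2 * k^2)"
    proof -
      have "k * (9 * B - 2 * k^2) * (k * F) - 27 * (B * T^2)
          = (k^2 - 3 * B) * (144 * B^2 + 12 * B * k^2 - 10 * k^4)"
        unfolding F_def T_def by algebra
      moreover have "0 < 144 * B^2 + 12 * B * k^2 - 10 * k^4"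
      proof -
        have "k^2 * k^2 < (4 * B) * k^2"
          using assms(1) k_pos by (intro mult_strict_right_mono) auto
        moreover have "(4 * B) * k^2 < (4 * B) * (4 * B)"
          using assms(1) B_pos by (intro mult_strict_left_mono) auto
        moreover have "k^4 = k^2 * k^2" by (simp flip: power_add)
        moreover have "0 < k^2 * k^2" using k_pos by simp
        ultimately show ?thesis by (simp add: power2_eq_square)
      qed
      ultimately have "27 * (B * T^2) < k * (9 * B - 2 * k^2) * (k * F)"
        using B_less by (smt (verit) mult_pos_pos)
      then show ?thesis using kF by (simp add: h0_def divide_less_eq)
    qed
    have h0_eq: "h0 * (k * F) = B * T^2" by (metis h0_def kF less_irrefl nonzero_eq_divide_eq)
    define \<Delta> where "\<Delta> = (\<lambda>x. B^2 * T - 4 * k^3 * x + 18 * k * B * x - 27 * x^2)"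
    have "\<Delta> h0 - \<Delta> (h s) = (h0 - h s) * (2 * (k * (9 * B - 2 * k^2)) - 27 * (h0 + h s))"
      unfolding \<Delta>_def by algebra
    also have "\<dots> \<ge> 0" using le vertex by (intro mult_nonneg_nonneg) auto
    finally have "\<Delta> (h s) \<le> \<Delta> h0" by simp
    moreover have "0 < \<Delta> (h s)"
      unfolding \<Delta>_def discriminant_eq[symmetric] using s by (auto simp: dom_def cdom_def)
    ultimately have "0 < \<Delta> h0" by linarith
    then have pos: "0 < \<Delta> h0 * (k * F)^2" using k_pos F by (intro mult_pos_pos zero_less_power)
    have "\<Delta> h0 * (k * F)^2 = B^2 * T * (k * F)^2 - 4 * k^3 * (h0 * (k * F)) * (k * F)
        + 18 * k * B * (h0 * (k * F)) * (k * F) - 27 * (h0 * (k * F))^2"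
      unfolding \<Delta>_def by algebra
    \<comment> \<open>The quartic form of \<open>R_m_sgn\<close> reappears as a factor. For
      \<open>k^2 < 4 * B\<close> it is positive while \<open>T\<close> is negative, so the
      discriminant is negative at \<open>h0\<close>.\<close>
    also have "\<dots> = 4 * (B * T) * ((48 * B^2 + 24 * B * k^2 - 5 * k^4) * (3 * B - k^2)^2)"
      unfolding h0_eq unfolding F_def T_def by algebra
    also have "\<dots> < 0"
    proof (rule mult_neg_pos[OF _ mult_pos_pos])
      show "4 * (B * T) < 0" using B_pos T by (simp add: mult_pos_neg)
      show "0 < (3 * B - k^2)^2" using B_less by simp
      have "k^2 * k^2 < (4 * B) * k^2"
          using assms(1) k_pos by (intro mult_strict_right_mono) auto
        moreover have "(4 * B) * k^2 < (4 * B) * (4 * B)"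
          using assms(1) B_pos by (intro mult_strict_left_mono) auto
        moreover have "k^4 = k^2 * k^2" by (simp flip: power_add)
      moreover have "0 < k^2 * k^2" using k_pos by simp
      ultimately show "0 < 48 * B^2 + 24 * B * k^2 - 5 * k^4" by (simp add: power2_eq_square)
    qed
    finally show False using pos by simp
  qed
qed

section \<open>Existence and uniqueness of the zero of \<open>N\<close>\<close>

lemma N_pos_after:
  assumes "s \<in> dom" "t \<in> dom" "s < t" "0 \<le> N s"
  shows "0 < N t"
proof -
  have s: "s \<in> cdom" "m < s" using assms(1) by (auto simp: dom_iff)
  \<comment> \<open>Otherwise \<open>R\<close> would be negative on the whole way from
    \<open>m\<close> to \<open>s\<close>, so \<nu> would fall below its value 0 at the centre,
    against \<open>0 \<le> N s\<close>. From \<open>s\<close> on, positivity of \<open>R\<close>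
    keeps \<nu> increasing.\<close>
  have "0 < R s"
  proof (rule ccontr)
    assume neg: "\<not> 0 < R s"
    have "R u < 0" if "m < u" "u < s" for u
      using R_less[of u s] m_to_dom(1)[OF assms(1), of u] s that neg by simp
    then have "\<nu> s < \<nu> m" by (intro \<nu>_less(2)[OF assms(1)]) (use s in auto)
    then show False using \<nu>_sign(2)[OF s(1)] assms(4) by (simp add: \<nu>_m)
  qed
  have "0 < R u" if "s < u" "u < t" for u
    using R_less[of s u] m_to_dom(1)[OF assms(2), of u] s that \<open>0 < R s\<close> by simp
  then have "\<nu> s < \<nu> t" by (intro \<nu>_less(1)[OF assms(2)]) (use s assms in auto)
  moreover have "0 \<le> \<nu> s" using \<nu>_sign(2)[OF s(1)] assms(4) by (simp add: not_less[symmetric])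
  ultimately show "0 < N t" using \<nu>_sign(1)[OF dom_cdom[OF assms(2)]] by simp
qed

text \<open>The smaller solution of \<open>s^2 = Q s\<close>: there the lowest root reaches 0 and
  \<open>h\<close> vanishes.\<close>

definition s_end :: real where "s_end = (k - sqrt T) / 4"

context
  assumes T_pos: "0 < T"
begin

lemma s_end_eq: "4 * s_end^2 - 2 * k * s_end + B = 0" "4 * s_end < k"
proof -
  have "k - 4 * s_end = sqrt T" by (simp add: s_end_def diff_divide_distrib)
  then have "(k - 4 * s_end)^2 = k^2 - 4 * B" using T_pos by (simp add: T_def)
  then show "4 * s_end^2 - 2 * k * s_end + B = 0" by (simp add: power2_eq_square algebra_simps)
  show "4 * s_end < k" using T_pos by (simp add: s_end_def)
qed

lemma s_end_dom:
  assumes "m < s" "s < s_end"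
  shows "s \<in> dom"
proof -
  have s: "4 * s < k" "3 * s < k" using assms s_end_eq(2) m_bounds k_pos by auto
  have "s^2 - Q s = 2 * (s_end - s) * (k - 2 * (s_end + s))"
    using s_end_eq(1) unfolding Q_def by algebra
  also have "\<dots> > 0" using assms s s_end_eq(2) by (intro mult_pos_pos) auto
  finally have "Q s < s^2" by simp
  moreover have "0 < P s"
  proof -
    \<comment> \<open>The last two terms are \<open>2 * P s_end\<close>; the first is twice the
      difference \<open>P s - P s_end\<close>.\<close>
    have "2 * P s = 2 * ((s_end - s) * (8 * k - 12 * (s_end + s))) + T + k * (k - 4 * s_end)"
      unfolding P_def Q_def T_def using s_end_eq(1) by algebra
    moreover have "0 \<le> (s_end - s) * (8 * k - 12 * (s_end + s))"
      using assms s s_end_eq(2) k_pos by (intro mult_nonneg_nonneg) auto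
    moreover have "0 < k * (k - 4 * s_end)" using k_pos s_end_eq(2) by simp
    ultimately show ?thesis using T_pos by simp
  qed
  ultimately show ?thesis
    using s assms(1) Q_pos_iff[of s] by (auto simp: dom_def cdom_def)
qed

lemma m_less_s_end: "m < s_end"
proof -
  have "0 < s_end"
  proof -
    have "sqrt T < k" using k_pos B_pos by (intro real_less_lsqrt) (auto simp: T_def)
    then show ?thesis by (simp add: s_end_def)
  qed
  moreover have "Q s_end = s_end^2" using s_end_eq(1) by (simp add: Q_def)
  moreover have "3 * s_end < k" using s_end_eq(2) \<open>0 < s_end\<close> by simp
  ultimately show ?thesis using Q_pos_iff[of s_end] by simp
qed

text \<open>Since \<open>K0\<close> is bounded below, the derivative of \<open>\<nu> = h powr - c * N\<close> dominates that of \<open>h powr - c\<close>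
  near the end where \<open>h\<close> tends to 0; this avoids the logarithmic asymptotics of \<open>K0\<close>.\<close>
lemma N_pos_exists: "\<exists>s\<in>dom. 0 < N s"
proof -
  define c where "c = T / (4 * D)"
  \<comment> \<open>Near the end, \<open>R \<ge> B * T^2 / 2\<close> and
    \<open>K0 \<ge> 2 * pi / k\<close> give \<open>R * K0 / (2 * D) \<ge> 2 * c * \<rho>\<close>.
    This is exactly what makes \<open>\<nu> - \<rho> * h powr - c\<close> nondecreasing.\<close>
  define \<rho> where "\<rho> = B * T * pi / k"
  have c: "0 < c" using T_pos D_pos by (simp add: c_def)
  have \<rho>: "0 < \<rho>" using T_pos B_pos k_pos by (simp add: \<rho>_def)
  have "isCont h s_end" by (rule DERIV_isCont[OF h_deriv])
  moreover have "h s_end = 0" using s_end_eq(1) by (simp add: h_def Q_def)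
  ultimately have h0: "(h \<longlongrightarrow> 0) (at_left s_end)"
    by (metis isCont_def filterlim_at_split)
  \<comment> \<open>Half of the value of \<open>h\<close> at which \<open>R\<close> vanishes, so
    that \<open>h \<le> \<delta>\<close> yields \<open>R \<ge> B * T^2 / 2\<close>.\<close>
  define \<delta> where "\<delta> = B * T^2 / (2 * (k * (5 * k^2 - 12 * B)))"
  have "0 < \<delta>" using T_pos B_pos k_pos F_pos by (simp add: \<delta>_def)
  have ev: "\<forall>\<^sub>F s in at_left s_end. a < s \<and> s < s_end" if "a < s_end" for a
    using eventually_at_left_real[OF that] by (simp add: greaterThanLessThan_iff)
  have "\<forall>\<^sub>F s in at_left s_end. h s < \<delta> \<and> m < s \<and> s < s_end"
    by (rule eventually_conj[OF order_tendstoD(2)[OF h0 \<open>0 < \<delta>\<close>] ev[OF m_less_s_end]])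
  then obtain a where a: "h a < \<delta>" "m < a" "a < s_end"
    using eventually_happens' trivial_limit_at_left_real by blast
  have adom: "a \<in> dom" by (rule s_end_dom[OF a(2,3)])
  define \<mu> where "\<mu> = (\<lambda>s. \<nu> s - \<rho> * h s powr - c)"
  have mono: "\<mu> a \<le> \<mu> s" if s: "a \<le> s" "s < s_end" for s
  proof (rule DERIV_nonneg_imp_nondecreasing[OF s(1)])
    fix u assume u: "a \<le> u" "u \<le> s"
    then have ud: "u \<in> dom" using a s by (intro s_end_dom) auto
    note uc = dom_cdom[OF ud]
    have hu: "0 < h u" by (rule h_pos[OF uc])
    have "h u \<le> h a"
      using h_less[OF dom_cdom[OF adom] uc] u by (cases "a = u") auto
    then have "h u * (k * (5 * k^2 - 12 * B)) \<le> \<delta> * (k * (5 * k^2 - 12 * B))"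
      using a k_pos F_pos by (intro mult_right_mono) auto
    also have "\<dots> = B * T^2 / 2" using k_pos F_pos by (simp add: \<delta>_def)
    finally have R: "B * T^2 / 2 \<le> R u" by (simp add: R_def mult_ac)
    define w where "w = P u * h u powr (- c - 1)"
    have w: "0 < w" using uc hu by (simp add: w_def cdom_def)
    have "((\<lambda>s. h s powr - c) has_real_derivative - c * h u powr (- c - 1) * (- 2 * P u)) (at u)"
      by (rule DERIV_chain2[OF has_real_derivative_powr[OF hu] h_deriv])
    from DERIV_diff[OF \<nu>_deriv[OF ud] DERIV_cmult[OF this, of \<rho>]]
    have "(\<mu> has_real_derivative w * (R u * K0 u / (2 * D) - 2 * c * \<rho>)) (at u)"
      unfolding \<mu>_def by (rule DERIV_cong) (simp add: w_def c_def algebra_simps)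
    moreover have "2 * c * \<rho> \<le> R u * K0 u / (2 * D)"
    proof -
      have "(B * T^2 / 2) * (2 * pi / k) \<le> R u * K0 u"
        using R K0_ge[OF uc] B_pos k_pos by (intro mult_mono) (auto intro: order_trans[OF _ R])
      then have "(B * T^2 / 2) * (2 * pi / k) / (2 * D) \<le> R u * K0 u / (2 * D)"
        using D_pos by (intro divide_right_mono) auto
      then show ?thesis by (simp add: c_def \<rho>_def power2_eq_square mult_ac)
    qed
    ultimately show "\<exists>y. (\<mu> has_real_derivative y) (at u) \<and> 0 \<le> y"
      using w by (intro exI[of _ "w * (R u * K0 u / (2 * D) - 2 * c * \<rho>)"]) auto
  qed
  \<comment> \<open>Multiplying \<open>\<mu> a \<le> \<mu> s\<close> by \<open>h s powr c\<close>
    gives \<open>\<rho> + \<mu> a * h s powr c \<le> N s\<close>, and the left side tends to \<rho>,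
    which is positive.\<close>
  have "((\<lambda>s. \<rho> + \<mu> a * h s powr c) \<longlongrightarrow> \<rho> + \<mu> a * 0) (at_left s_end)"
  proof (intro tendsto_intros)
    have "\<forall>\<^sub>F s in at_left s_end. 0 \<le> h s"
      by (rule eventually_mono[OF ev[OF m_less_s_end]]) (use h_pos s_end_dom dom_cdom less_imp_le in metis)
    then show "((\<lambda>s. h s powr c) \<longlongrightarrow> 0) (at_left s_end)"
      using tendsto_powr2[OF h0 tendsto_const[of c] _ c] c by simp
  qed
  then have "\<forall>\<^sub>F s in at_left s_end. 0 < \<rho> + \<mu> a * h s powr c"
    using \<rho> by (intro order_tendstoD(1)) auto
  then have "\<forall>\<^sub>F s in at_left s_end. 0 < \<rho> + \<mu> a * h s powr c \<and> a < s \<and> s < s_end"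
    using ev[OF a(3)] by (rule eventually_conj)
  then obtain s where s: "0 < \<rho> + \<mu> a * h s powr c" "a < s" "s < s_end"
    using eventually_happens' trivial_limit_at_left_real by blast
  have sdom: "s \<in> dom" using s a by (intro s_end_dom) auto
  have hs: "h s powr - c * h s powr c = 1"
    using h_pos[OF dom_cdom[OF sdom]] by (simp flip: powr_add)
  have "\<mu> a * h s powr c \<le> \<mu> s * h s powr c"
    using mono[of s] s by (intro mult_right_mono) auto
  also have "\<mu> s * h s powr c = (h s powr - c * h s powr c) * (N s - \<rho>)"
    unfolding \<mu>_def \<nu>_def c_def by (simp add: algebra_simps)
  finally have "0 < N s" using s(1) by (simp add: hs)
  then show ?thesis using sdom by blast
qed

text \<open>The hypothesis makes \<open>R\<close> negative at the centre, hence \<open>N\<close>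
  negative just beyond it. As \<open>N\<close> is positive somewhere, it has a zero, and
  \<open>N_pos_after\<close> allows only one sign change.\<close>

lemma L_unimodal:
  assumes "0 < 48 * B^2 + 24 * B * k^2 - 5 * k^4"
  shows "\<exists>s\<in>dom. (\<forall>a\<in>dom. \<forall>b\<in>dom. a < b \<and> b \<le> s \<longrightarrow> L a < L b)
    \<and> (\<forall>a\<in>dom. \<forall>b\<in>dom. s \<le> a \<and> a < b \<longrightarrow> L b < L a)"
proof -
  obtain s1 where s1: "s1 \<in> dom" "0 < N s1" using N_pos_exists by blast
  have "sgn (R m) = - 1" using R_m_sgn assms by simp
  then have "R m < 0" by (simp add: sgn_1_neg)
  have "(R \<longlongrightarrow> R m) (at_right m)"
    unfolding R_def using DERIV_isCont[OF h_deriv, of m]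
    by (intro tendsto_intros) (metis isCont_def filterlim_at_split)
  from order_tendstoD(2)[OF this \<open>R m < 0\<close>]
  have "\<forall>\<^sub>F s in at_right m. R s < 0 \<and> s \<in> {m<..<s1}"
    using s1(1) by (intro eventually_conj eventually_at_right_real) (auto simp: dom_iff)
  then obtain s0 where s0: "R s0 < 0" "m < s0" "s0 < s1"
    using eventually_happens' trivial_limit_at_right_real greaterThanLessThan_iff by blast
  have s0d: "s0 \<in> dom" using m_to_dom(2)[OF s1(1), of s0] s0 by simp
  have "N s0 < 0"
  proof -
    have "R u < 0" if "m < u" "u < s0" for u
      using R_less[OF m_to_dom(1)[OF s0d, of u] dom_cdom[OF s0d]] s0 that by simp
    then have "\<nu> s0 < \<nu> m" using s0 by (intro \<nu>_less(2)[OF s0d]) auto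
    then show ?thesis using \<nu>_sign(2)[OF dom_cdom[OF s0d]] by (simp add: \<nu>_m)
  qed
  have "continuous_on {s0..s1} N"
    by (rule continuous_on_subset[OF continuous_N]) (use dom_between[OF s0d s1(1)] dom_cdom in auto)
  with \<open>N s0 < 0\<close> s1(2) s0(3) obtain s where s: "s0 \<le> s" "s \<le> s1" "N s = 0"
    using IVT'[of N s0 0 s1] by auto
  have sd: "s \<in> dom" by (rule dom_between[OF s0d s1(1) s(1,2)])
  have pos: "0 < N t" if "t \<in> dom" "s < t" for t
    using N_pos_after[OF sd that] s(3) by simp
  have neg: "N t < 0" if "t \<in> dom" "t < s" for t
    using N_pos_after[OF that(1) sd that(2)] s(3) by (cases "0 \<le> N t") auto
  show ?thesis
  proof (intro bexI[OF _ sd] conjI ballI impI)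
    fix a b assume ab: "a \<in> dom" "b \<in> dom" "a < b \<and> b \<le> s"
    show "L a < L b"
      by (rule L_less(2)[OF ab(1,2)]) (use ab dom_between[OF ab(1,2)] neg in auto)
  next
    fix a b assume ab: "a \<in> dom" "b \<in> dom" "s \<le> a \<and> a < b"
    show "L b < L a"
      by (rule L_less(1)[OF ab(1,2)]) (use ab dom_between[OF ab(1,2)] pos in auto)
  qed
qed

end

section \<open>Admissible parameters and the period\<close>

text \<open>In the coordinate \<open>x = C1 - \<phi>\<close>, this function is the left side of the
  critical point equation. Replacing \<open>k\<close> by \<open>3 * y\<close> or
  \<open>3 * x\<close> in the difference quotient makes it factor.\<close>

lemma cubic_strict_mono:
  fixes x y :: real
  assumes "x < y"
  shows "0 \<le> x \<Longrightarrow> 3 * y \<le> k \<Longrightarrow> x^2 * (k - 2 * x) < y^2 * (k - 2 * y)"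
    and "k \<le> 3 * x \<Longrightarrow> y^2 * (k - 2 * y) < x^2 * (k - 2 * x)"
proof -
  have diff: "y^2 * (k - 2 * y) - x^2 * (k - 2 * x) = (y - x) * (k * (x + y) - 2 * (x^2 + x * y + y^2))"
    by algebra
  show "x^2 * (k - 2 * x) < y^2 * (k - 2 * y)" if "0 \<le> x" "3 * y \<le> k"
  proof -
    have "0 < (y - x) * (y + 2 * x)" using assms that by (intro mult_pos_pos) auto
    also have "\<dots> = 3 * y * (x + y) - 2 * (x^2 + x * y + y^2)" by algebra
    also have "\<dots> \<le> k * (x + y) - 2 * (x^2 + x * y + y^2)"
      using assms that by (intro diff_right_mono mult_right_mono) auto
    finally have "0 < (y - x) * (k * (x + y) - 2 * (x^2 + x * y + y^2))" using assms by simp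
    then show ?thesis using diff by simp
  qed
  show "y^2 * (k - 2 * y) < x^2 * (k - 2 * x)" if "k \<le> 3 * x"
  proof -
    have "k * (x + y) - 2 * (x^2 + x * y + y^2) \<le> 3 * x * (x + y) - 2 * (x^2 + x * y + y^2)"
      using assms that k_pos by (intro diff_right_mono mult_right_mono) auto
    also have "\<dots> = (x - y) * (x + 2 * y)" by algebra
    also have "\<dots> < 0" using assms that k_pos by (intro mult_neg_pos) auto
    finally have "(y - x) * (k * (x + y) - 2 * (x^2 + x * y + y^2)) < 0"
      using assms by (intro mult_pos_neg) auto
    then show ?thesis using diff by simp
  qed
qed

lemma roots:
  assumes "s \<in> dom"
  obtains d where "d = sqrt (Q s)" "0 < d" "d^2 = Q s" "d < s" "d < k - 3 * s"
    "h s = (s - d) * (s + d) * (k - 2 * s)"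
    "\<And>x. x^3 - k * x^2 + B * x - h s = (x - (s - d)) * (x - (s + d)) * (x - (k - 2 * s))"
proof -
  define d where "d = sqrt (Q s)"
  have Q: "d^2 = Q s" "0 < d" using assms by (auto simp: d_def dom_def)
  have h: "h s = (s - d) * (s + d) * (k - 2 * s)"
    unfolding h_def Q(1)[symmetric] by algebra
  have "B = 2 * k * s - 3 * s^2 - d^2" using Q(1) by (simp add: Q_def)
  then have "x^3 - k * x^2 + B * x - h s = (x - (s - d)) * (x - (s + d)) * (x - (k - 2 * s))" for x
    unfolding h by algebra
  then show ?thesis
    using that[of d] Q h sqrt_Q_bounds[OF dom_cdom[OF assms]] by (simp add: d_def)
qed

context
  fixes C1 C2 b :: real
  assumes k_eq: "k = 2 * C1 + C2" and B_eq: "B = 2 * b + C1^2 + 2 * C1 * C2"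
begin

lemma Upot_eq:
  assumes "x \<noteq> 0"
  shows "2 * (b - Upot C1 C2 C (C1 - x)) = (x^3 - k * x^2 + B * x - C) / x"
proof -
  have U: "Upot C1 C2 C (C1 - x)
      = - (1/2) * (C1 - x)^2 - (1/2) * C2 * (C1 - x) - (1/2) * C1 * C2 + C / (2 * x)"
    by (simp add: Upot_def)
  have "2 * (b - Upot C1 C2 C (C1 - x)) = x^2 - k * x + B - C / x"
    unfolding U k_eq B_eq by (simp add: power2_eq_square algebra_simps add_divide_distrib diff_divide_distrib)
  then show ?thesis using assms by (simp add: power2_eq_square power3_eq_cube field_simps)
qed

lemma C3crit_eq: "(k / 3)^2 * (k - 2 * (k / 3)) = C3crit C1 C2"
  unfolding C3crit_def k_eq[symmetric] by (simp add: power2_eq_square power3_eq_cube)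

text \<open>The reflection \<open>x = C1 - \<phi>\<close> reverses the order, so \<open>phi1\<close>
  belongs to the larger point \<open>y1\<close>. Existence is by intermediate values, and uniqueness
  for \<open>THE\<close> by strict monotonicity on either side of \<open>k / 3\<close>.\<close>

lemma critical_points:
  assumes "0 < C" "C < C3crit C1 C2"
  obtains y1 y2 where "0 < y2" "3 * y2 < k" "k < 3 * y1" "2 * y1 < k"
    "y1^2 * (k - 2 * y1) = C" "y2^2 * (k - 2 * y2) = C"
    "phi1 C1 C2 C = C1 - y1" "phi2 C1 C2 C = C1 - y2"
proof -
  let ?f = "\<lambda>x::real. x^2 * (k - 2 * x)"
  note fk = C3crit_eq
  have cont: "continuous_on S ?f" for S by (intro continuous_intros)
  obtain y2 where y2: "0 \<le> y2" "y2 \<le> k / 3" "?f y2 = C"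
    using IVT'[of ?f 0 C "k / 3", OF _ _ _ cont] assms fk k_pos by auto
  obtain y1 where y1: "k / 3 \<le> y1" "y1 \<le> k / 2" "?f y1 = C"
    using IVT2'[of ?f "k / 2" C "k / 3", OF _ _ _ cont] assms fk k_pos by auto
  have ne: "y2 \<noteq> 0" "y2 \<noteq> k / 3" "y1 \<noteq> k / 3" "y1 \<noteq> k / 2"
    using assms fk y1(3) y2(3) by auto
  have tr: "2 * (\<phi> - C1)^2 * (\<phi> + C2 / 2) = ?f (C1 - \<phi>)" for \<phi>
    unfolding k_eq by (simp add: power2_eq_square algebra_simps)
  have "phi1 C1 C2 C = C1 - y1"
    unfolding phi1_def tr
  proof (rule the_equality)
    show "- C2 / 2 < C1 - y1 \<and> C1 - y1 < (C1 - C2) / 3 \<and> ?f (C1 - (C1 - y1)) = C"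
      using y1 ne k_eq by auto
    fix \<phi> assume \<phi>: "- C2 / 2 < \<phi> \<and> \<phi> < (C1 - C2) / 3 \<and> ?f (C1 - \<phi>) = C"
    then have "k \<le> 3 * (C1 - \<phi>)" using k_eq by auto
    with \<phi> y1 cubic_strict_mono(2)[of y1 "C1 - \<phi>"] cubic_strict_mono(2)[of "C1 - \<phi>" y1]
    show "\<phi> = C1 - y1" by (cases "C1 - \<phi>" y1 rule: linorder_cases) auto
  qed
  moreover have "phi2 C1 C2 C = C1 - y2"
    unfolding phi2_def tr
  proof (rule the_equality)
    show "(C1 - C2) / 3 < C1 - y2 \<and> C1 - y2 < C1 \<and> ?f (C1 - (C1 - y2)) = C"
      using y2 ne k_eq by auto
    fix \<phi> assume \<phi>: "(C1 - C2) / 3 < \<phi> \<and> \<phi> < C1 \<and> ?f (C1 - \<phi>) = C"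
    then have "3 * (C1 - \<phi>) \<le> k" using k_eq by auto
    with \<phi> y2 cubic_strict_mono(1)[of y2 "C1 - \<phi>"] cubic_strict_mono(1)[of "C1 - \<phi>" y2]
    show "\<phi> = C1 - y2" by (cases "C1 - \<phi>" y2 rule: linorder_cases) auto
  qed
  ultimately show ?thesis
    using that[of y2 y1] y1 y2 ne by auto
qed

text \<open>The cubic is negative at 0, positive at \<open>y2\<close> since \<open>b\<close> exceeds
  \<open>bminus\<close>, and negative at \<open>y1\<close> since \<open>b\<close> is below
  \<open>bplus\<close>. This gives two roots \<open>r1 < r2\<close>, whose midpoint is the
  parameter.\<close>

lemma admC3_parameter:
  assumes "C \<in> admC3 C1 C2 b"
  shows "\<exists>s\<in>dom. h s = C"
proof -
  have C: "0 < C" "C < C3crit C1 C2" "bminus C1 C2 C < b" "b < bplus C1 C2 C"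
    using assms by (auto simp: admC3_def)
  obtain y1 y2 where y: "0 < y2" "3 * y2 < k" "k < 3 * y1" "2 * y1 < k"
    "phi1 C1 C2 C = C1 - y1" "phi2 C1 C2 C = C1 - y2"
    by (rule critical_points[OF C(1,2)])
  let ?q = "\<lambda>x. x^3 - k * x^2 + B * x - C"
  have "0 < ?q y2 / y2"
    using C(3) Upot_eq[of y2 C] y by (simp add: bminus_def)
  then have q2: "0 < ?q y2" using y by (simp add: zero_less_divide_iff)
  have "?q y1 / y1 < 0"
    using C(4) Upot_eq[of y1 C] y by (simp add: bplus_def)
  then have q1: "?q y1 < 0" using y k_pos by (simp add: divide_less_0_iff)
  have cont: "continuous_on S ?q" for S by (intro continuous_intros)
  obtain r1 where r1: "0 \<le> r1" "r1 \<le> y2" "?q r1 = 0"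
    using IVT'[of ?q 0 0 y2, OF _ _ _ cont] q2 C y by auto
  obtain r2 where r2: "y2 \<le> r2" "r2 \<le> y1" "?q r2 = 0"
    using IVT2'[of ?q y1 0 y2, OF _ _ _ cont] q1 q2 y by auto
  have lt: "0 < r1" "r1 < y2" "y2 < r2" "r2 < y1"
    using r1 r2 q1 q2 C by (auto simp: less_le)
  define s where "s = (r1 + r2) / 2"
  have rr: "r1 + r2 = 2 * s" by (simp add: s_def)
  \<comment> \<open>Division of the difference of the two root equations by \<open>r2 - r1\<close>
    determines \<open>B\<close>, and with it the third root \<open>k - 2 * s\<close>.\<close>
  have "(r2 - r1) * (r2^2 + r1 * r2 + r1^2 - k * (r1 + r2) + B) = ?q r2 - ?q r1" by algebra
  then have e2: "r2^2 + r1 * r2 + r1^2 - k * (r1 + r2) + B = 0"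
    using r1 r2 lt by simp
  have "4 * Q s = (r2 - r1)^2"
    using e2 rr unfolding Q_def by algebra
  then have Q: "Q s = ((r2 - r1) / 2)^2" by (simp add: power_divide)
  have s2: "s^2 - Q s = r1 * r2"
    unfolding Q unfolding s_def by (simp add: power2_eq_square field_simps)
  have C_eq: "C = r1 * r2 * (k - 2 * s)"
    using r1(3) e2 unfolding rr[symmetric] by algebra
  have fact: "?q x = (x - r1) * (x - r2) * (x - (k - 2 * s))" for x
    using e2 unfolding C_eq rr[symmetric] by algebra
  \<comment> \<open>The point \<open>y1\<close> lies beyond both roots and the cubic is negative
    there, so the third root is still larger.\<close>
  have "0 < (y1 - r1) * (y1 - r2)" using lt y by simp
  then have "y1 < k - 2 * s"
    using q1 lt unfolding fact by (auto simp: mult_less_0_iff)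
  then have r3: "r2 < k - 2 * s" using lt by simp
  have "P s = (k - 2 * s - r1) * (k - 2 * s - r2)"
    unfolding P_def Q unfolding s_def by (simp add: power2_eq_square field_simps)
  then have "0 < P s" using r3 lt by simp
  moreover have "0 < s^2 - Q s" unfolding s2 using lt by (intro mult_pos_pos) auto
  moreover have "0 < Q s" unfolding Q using lt by simp
  ultimately have "s \<in> dom"
    using lt r3 rr by (auto simp: dom_def cdom_def)
  moreover have "h s = C" by (simp add: h_def s2 C_eq)
  ultimately show ?thesis by blast
qed

text \<open>The core is the interlacing \<open>r1 < y2 < r2 < y1 < r3\<close> of roots and critical
  points. It fixes the signs of the cubic at \<open>y1\<close> and \<open>y2\<close> and singles out
  the roots meant by \<open>phi_plus\<close> and \<open>phi_minus\<close>.\<close>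

lemma parameter_admC3:
  assumes s: "s \<in> dom"
  shows "h s \<in> admC3 C1 C2 b"
    and "phi_plus C1 C2 (h s) b = C1 - (s - sqrt (Q s))"
    and "phi_minus C1 C2 (h s) b = C1 - (s + sqrt (Q s))"
proof -
  obtain d where d: "d = sqrt (Q s)" "0 < d" "d < s" "d < k - 3 * s"
    "h s = (s - d) * (s + d) * (k - 2 * s)"
    "\<And>x. x^3 - k * x^2 + B * x - h s = (x - (s - d)) * (x - (s + d)) * (x - (k - 2 * s))"
    by (rule roots[OF s]) blast
  define r1 r2 r3 where "r1 = s - d" and "r2 = s + d" and "r3 = k - 2 * s"
  have r: "0 < r1" "r1 < r2" "r2 < r3" "k = r1 + r2 + r3"
    using d by (auto simp: r1_def r2_def r3_def)
  have rk: "3 * r1 < k" "k < 3 * r3" using r by linarith+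
  note q = d(6)[folded r1_def r2_def r3_def]
  have h: "h s = r1 * r2 * r3" using d(5) by (simp add: r1_def r2_def r3_def)
  let ?f = "\<lambda>x. x^2 * (k - 2 * x)"
  \<comment> \<open>The derivative of the cubic divided by \<open>x\<close> is
    \<open>(h s - ?f x) / x^2\<close>. The three comparisons record its sign at the three simple
    roots, and monotonicity of \<open>?f\<close> turns them into the interlacing.\<close>
  have f1: "?f r1 < h s"
  proof -
    have "h s - ?f r1 = r1 * ((r2 - r1) * (r3 - r1))" using h r(4) by algebra
    also have "\<dots> > 0" using r by simp
    finally show ?thesis by simp
  qed
  have f2: "h s < ?f r2"
  proof -
    have "?f r2 - h s = r2 * ((r2 - r1) * (r3 - r2))" using h r(4) by algebra
    also have "\<dots> > 0" using r by simp
    finally show ?thesis by simp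
  qed
  have f3: "?f r3 < h s"
  proof -
    have "h s - ?f r3 = r3 * ((r3 - r1) * (r3 - r2))" using h r(4) by algebra
    also have "\<dots> > 0" using r by simp
    finally show ?thesis by simp
  qed
  have "?f r2 \<le> ?f (k / 3)"
  proof (cases r2 "k / 3" rule: linorder_cases)
    case less
    with r(1,2) show ?thesis by (intro less_imp_le[OF cubic_strict_mono(1)]) auto
  next
    case greater
    then show ?thesis by (intro less_imp_le[OF cubic_strict_mono(2)]) auto
  qed (simp only: order_refl)
  also have "\<dots> = C3crit C1 C2" by (rule C3crit_eq)
  finally have crit: "h s < C3crit C1 C2" using f2 by simp
  have h0: "0 < h s" by (rule h_pos[OF dom_cdom[OF s]])
  obtain y1 y2 where y: "0 < y2" "3 * y2 < k" "k < 3 * y1" "2 * y1 < k"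
    "?f y1 = h s" "?f y2 = h s" "phi1 C1 C2 (h s) = C1 - y1" "phi2 C1 C2 (h s) = C1 - y2"
    by (rule critical_points[OF h0 crit])
  have "r1 < y2"
  proof (rule ccontr)
    assume "\<not> r1 < y2"
    then have "y2 < r1 \<or> y2 = r1" by auto
    then show False
      using cubic_strict_mono(1)[of y2 r1] f1 y(1-6) r(1-3) rk by (elim disjE) (linarith, simp)
  qed
  moreover have "y2 < r2"
  proof (rule ccontr)
    assume "\<not> y2 < r2"
    then have "r2 < y2 \<or> r2 = y2" by auto
    then show False
      using cubic_strict_mono(1)[of r2 y2] f2 y(1-6) r(1-3) rk by (elim disjE) (linarith, simp)
  qed
  moreover have "r2 < y1"
  proof (rule ccontr)
    assume "\<not> r2 < y1"
    then have "y1 < r2 \<or> y1 = r2" by auto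
    then show False
      using cubic_strict_mono(2)[of y1 r2] f2 y(1-6) r(1-3) rk by (elim disjE) (linarith, simp)
  qed
  moreover have "y1 < r3"
  proof (rule ccontr)
    assume "\<not> y1 < r3"
    then have "r3 < y1 \<or> r3 = y1" by auto
    then show False
      using cubic_strict_mono(2)[of r3 y1] f3 y(1-6) r(1-3) rk by (elim disjE) (linarith, simp)
  qed
  ultimately have ry: "r1 < y2" "y2 < r2" "r2 < y1" "y1 < r3" .
  have U: "2 * (b - Upot C1 C2 (h s) (C1 - x)) = (x - r1) * (x - r2) * (x - r3) / x" if "x \<noteq> 0" for x
    using Upot_eq[OF that, of "h s"] q by simp
  have "0 < (y2 - r1) * (y2 - r2) * (y2 - r3) / y2"
    using ry r y by (intro divide_pos_pos mult_neg_neg mult_pos_neg) auto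
  then have "bminus C1 C2 (h s) < b" using U[of y2] y by (simp add: bminus_def)
  moreover have "(y1 - r1) * (y1 - r2) * (y1 - r3) / y1 < 0"
    using ry r y by (intro divide_neg_pos mult_pos_neg mult_pos_pos) auto
  then have "b < bplus C1 C2 (h s)" using U[of y1] y k_pos by (simp add: bplus_def)
  ultimately show "h s \<in> admC3 C1 C2 b" using h0 crit by (simp add: admC3_def)
  have Ub: "Upot C1 C2 (h s) \<phi> = b \<longleftrightarrow> C1 - \<phi> \<in> {r1, r2, r3}" if "\<phi> < C1" for \<phi>
    using U[of "C1 - \<phi>"] that by auto
  have "phi_plus C1 C2 (h s) b = C1 - r1"
    unfolding phi_plus_def y
  proof (rule the_equality)
    show "C1 - y2 < C1 - r1 \<and> C1 - r1 < C1 \<and> Upot C1 C2 (h s) (C1 - r1) = b"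
      using ry r Ub by auto
    fix \<phi> assume "C1 - y2 < \<phi> \<and> \<phi> < C1 \<and> Upot C1 C2 (h s) \<phi> = b"
    then show "\<phi> = C1 - r1" using Ub[of \<phi>] ry by auto
  qed
  then show "phi_plus C1 C2 (h s) b = C1 - (s - sqrt (Q s))" by (simp add: r1_def d(1))
  have "phi_minus C1 C2 (h s) b = C1 - r2"
    unfolding phi_minus_def y
  proof (rule the_equality)
    show "C1 - y1 < C1 - r2 \<and> C1 - r2 < C1 - y2 \<and> Upot C1 C2 (h s) (C1 - r2) = b"
      using ry r Ub by auto
    fix \<phi> assume "C1 - y1 < \<phi> \<and> \<phi> < C1 - y2 \<and> Upot C1 C2 (h s) \<phi> = b"
    then show "\<phi> = C1 - r2" using Ub[of \<phi>] ry y by auto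
  qed
  then show "phi_minus C1 C2 (h s) b = C1 - (s + sqrt (Q s))" by (simp add: r2_def d(1))
qed

lemma admC3_eq: "admC3 C1 C2 b = h ` dom"
  using admC3_parameter parameter_admC3(1) by blast

text \<open>This is the substitution \<open>C1 - \<phi> = s + sqrt (Q s) * sin \<theta>\<close>. As
  the original integrand is unbounded near both ends, an antiderivative is built that is continuous
  on the closed interval and differentiable inside.\<close>

lemma period_eq:
  assumes s: "s \<in> dom"
  shows "period C1 C2 (h s) b = L s"
proof -
  obtain d where d: "d = sqrt (Q s)" "0 < d" "d^2 = Q s" "d < s" "d < k - 3 * s"
    "\<And>x. x^3 - k * x^2 + B * x - h s = (x - (s - d)) * (x - (s + d)) * (x - (k - 2 * s))"
    by (rule roots[OF s]) blast
  let ?w = "\<lambda>\<theta>. X s \<theta> * g s \<theta>"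
  let ?y = "\<lambda>\<phi>. (C1 - s - \<phi>) / d"
  \<comment> \<open>The arcsine recovers \<theta> from \<phi>; the minus sign is there because
    \<theta> decreases as \<phi> grows.\<close>
  define \<Psi> where "\<Psi> = (\<lambda>\<phi>. - integral {- (pi/2)..arcsin (?y \<phi>)} ?w)"
  have w_cont: "continuous_on I ?w"
    by (intro continuous_on_mult continuous_X_slice continuous_g_slice dom_cdom s)
  have y_range: "-1 \<le> ?y \<phi> \<and> ?y \<phi> \<le> 1" if "\<phi> \<in> {C1 - (s + d)..C1 - (s - d)}" for \<phi>
    using that d(2) by (auto simp: field_simps)
  have cont: "continuous_on {C1 - (s + d)..C1 - (s - d)} \<Psi>"
    unfolding \<Psi>_def
  proof (intro continuous_on_minus continuous_on_compose2[OF indefinite_integral_continuous_1])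
    show "?w integrable_on I" by (rule integrable_continuous_interval[OF w_cont])
    show "continuous_on {C1 - (s + d)..C1 - (s - d)} (\<lambda>\<phi>. arcsin (?y \<phi>))"
      using y_range d(2) by (intro continuous_intros) auto
    show "(\<lambda>\<phi>. arcsin (?y \<phi>)) ` {C1 - (s + d)..C1 - (s - d)} \<subseteq> I"
      using y_range arcsin_bounded by auto
  qed
  have "((\<lambda>\<phi>. 1 / sqrt (2 * (b - Upot C1 C2 (h s) \<phi>))) has_integral
      \<Psi> (C1 - (s - d)) - \<Psi> (C1 - (s + d))) {C1 - (s + d)..C1 - (s - d)}"
  proof (rule fundamental_theorem_of_calculus_interior[OF _ cont])
    fix \<phi> assume \<phi>: "\<phi> \<in> {C1 - (s + d)<..<C1 - (s - d)}"
    then have y: "-1 < ?y \<phi>" "?y \<phi> < 1" using d(2) by (auto simp: field_simps)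
    define \<theta> where "\<theta> = arcsin (?y \<phi>)"
    have \<theta>: "- (pi/2) < \<theta>" "\<theta> < pi/2"
      using arcsin_lt_bounded[OF y] by (auto simp: \<theta>_def)
    have x: "X s \<theta> = C1 - \<phi>"
      using y d(2) by (simp add: X_def \<theta>_def d(1)[symmetric])
    have "((\<lambda>u. integral {- (pi/2)..u} ?w) has_real_derivative ?w \<theta>) (at \<theta>)"
      using integral_has_real_derivative[OF w_cont, of \<theta>] \<theta> at_within_Icc_at[of "- (pi/2)" \<theta> "pi/2"] by simp
    moreover have "((\<lambda>\<phi>. arcsin (?y \<phi>)) has_real_derivative inverse (sqrt (1 - (?y \<phi>)^2)) * (- 1 / d)) (at \<phi>)"
      by (rule DERIV_chain2[where f = arcsin and g = ?y, OF DERIV_arcsin[OF y]]) (use d(2) in \<open>auto intro!: derivative_eq_intros\<close>)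
    ultimately have "((\<lambda>\<phi>. integral {- (pi/2)..arcsin (?y \<phi>)} ?w) has_real_derivative
        ?w \<theta> * (inverse (sqrt (1 - (?y \<phi>)^2)) * (- 1 / d))) (at \<phi>)"
      unfolding \<theta>_def
      by (rule DERIV_chain2[where f = "\<lambda>u. integral {- (pi/2)..u} ?w" and g = "\<lambda>\<phi>. arcsin (?y \<phi>)"])
    then have "(\<Psi> has_real_derivative - (?w \<theta> * (inverse (sqrt (1 - (?y \<phi>)^2)) * (- 1 / d)))) (at \<phi>)"
      unfolding \<Psi>_def by (rule DERIV_minus)
    moreover have "- (?w \<theta> * (inverse (sqrt (1 - (?y \<phi>)^2)) * (- 1 / d)))
        = 1 / sqrt (2 * (b - Upot C1 C2 (h s) \<phi>))"
    proof -
      define z where "z = C1 - \<phi>"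
      have z: "0 < z" "0 < k - 2 * s - z" "s - d < z" "z < s + d"
        using X_bounds[OF dom_cdom[OF s], of \<theta>] \<phi> unfolding x z_def by auto
      define u where "u = (z - (s - d)) * ((s + d) - z)"
      have u: "0 < u" using z by (simp add: u_def)
      have "d * sqrt (1 - (?y \<phi>)^2) = sqrt (d^2 * (1 - (?y \<phi>)^2))"
        using d(2) by (simp add: real_sqrt_mult)
      also have "d^2 * (1 - (?y \<phi>)^2) = d^2 - (C1 - s - \<phi>)^2"
        using d(2) by (simp add: power_divide right_diff_distrib)
      also have "\<dots> = u" unfolding u_def z_def by algebra
      finally have l: "d * sqrt (1 - (?y \<phi>)^2) = sqrt u" .
      have "2 * (b - Upot C1 C2 (h s) \<phi>) = u * (k - 2 * s - z) / z"
      proof -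
        have "2 * (b - Upot C1 C2 (h s) (C1 - z)) = (z - (s - d)) * (z - (s + d)) * (z - (k - 2 * s)) / z"
          using Upot_eq[of z "h s"] d(6)[of z] z(1) by simp
        also have "(z - (s - d)) * (z - (s + d)) * (z - (k - 2 * s)) = u * (k - 2 * s - z)"
          unfolding u_def by algebra
        finally show ?thesis by (simp add: z_def)
      qed
      then have "1 / sqrt (2 * (b - Upot C1 C2 (h s) \<phi>)) = sqrt z / (sqrt u * sqrt (k - 2 * s - z))"
        by (simp add: real_sqrt_mult real_sqrt_divide)
      moreover have "?w \<theta> = sqrt z / sqrt (k - 2 * s - z)"
      proof -
        have "?w \<theta> = (z / sqrt z) / sqrt (k - 2 * s - z)"
          by (simp add: g_def x z_def real_sqrt_mult)
        then show ?thesis using z(1) by (simp only: real_div_sqrt less_imp_le)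
      qed
      ultimately show ?thesis
        unfolding l[symmetric] using d(2) by (simp add: field_simps)
    qed
    ultimately show "(\<Psi> has_vector_derivative 1 / sqrt (2 * (b - Upot C1 C2 (h s) \<phi>))) (at \<phi>)"
      by (simp add: has_real_derivative_iff_has_vector_derivative)
  qed (use d(2) in simp)
  moreover have "\<Psi> (C1 - (s - d)) - \<Psi> (C1 - (s + d)) = integral I ?w"
    using d(2) by (simp add: \<Psi>_def)
  ultimately have "integral {C1 - (s + d)..C1 - (s - d)} (\<lambda>\<phi>. 1 / sqrt (2 * (b - Upot C1 C2 (h s) \<phi>)))
      = integral I ?w"
    by (simp add: integral_unique)
  then show ?thesis
    by (simp only: period_def parameter_admC3(2,3)[OF s] d(1)[symmetric] L_def)
qed

end

end

section \<open>Translation of the thresholds and the three cases\<close>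

theorem theorem3:
  fixes C1 C2 b :: real
  assumes "2*C1 + C2 > 0"
  shows "(- (1/2)*C1^2 - C1*C2 < b \<and> b < b1const C1 C2 \<longrightarrow>
            strict_mono_on (admC3 C1 C2 b) (\<lambda>C3. period C1 C2 C3 b))
       \<and> (b1const C1 C2 < b \<and> b < (C2^2 - 4*C1*C2)/8 \<longrightarrow>
            (\<exists>Cs\<in>admC3 C1 C2 b.
               strict_mono_on (admC3 C1 C2 b \<inter> {..Cs}) (\<lambda>C3. period C1 C2 C3 b) \<and>
               strict_decr_on (admC3 C1 C2 b \<inter> {Cs..}) (\<lambda>C3. period C1 C2 C3 b)))
       \<and> ((C2^2 - 4*C1*C2)/8 < b \<and> b < (C1 - C2)^2/6 \<longrightarrow>
            strict_decr_on (admC3 C1 C2 b) (\<lambda>C3. period C1 C2 C3 b))"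
proof -
  define k where "k = 2 * C1 + C2"
  define B where "B = 2 * b + C1^2 + 2 * C1 * C2"
  \<comment> \<open>The positive root of \<open>48 * w^2 + 24 * w - 5\<close>, so that
    \<open>b = b1const C1 C2\<close> amounts to \<open>B = w * k^2\<close>.\<close>
  define w where "w = (2 * sqrt 6 - 3) / 12"
  have k: "0 < k" using assms by (simp add: k_def)
  have k2: "0 < k^2" using k by simp
  have "(2::real) < sqrt 6" "sqrt 6 < (3::real)" by (auto intro: real_less_rsqrt real_less_lsqrt)
  then have w: "0 < w" "w < 1 / 4" by (auto simp: w_def)
  have w_eq: "48 * w^2 + 24 * w - 5 = 0"
  proof -
    have "sqrt 6 ^ 2 = (6::real)" by simp
    then show ?thesis unfolding w_def by (simp add: power2_eq_square field_simps)
  qed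
  have b_iff: "- (1/2)*C1^2 - C1*C2 < b \<longleftrightarrow> 0 < B" "b < (C1 - C2)^2/6 \<longleftrightarrow> 3 * B < k^2"
    "b < (C2^2 - 4*C1*C2)/8 \<longleftrightarrow> 4 * B < k^2" "(C2^2 - 4*C1*C2)/8 < b \<longleftrightarrow> k^2 < 4 * B"
    by (auto simp: B_def k_def power2_eq_square algebra_simps)
  have "b1const C1 C2 = (w * k^2 - C1^2 - 2 * C1 * C2) / 2"
    unfolding b1const_def w_def k_def by (simp add: power2_eq_square field_simps)
  then have b1_iff: "b < b1const C1 C2 \<longleftrightarrow> B < w * k^2" "b1const C1 C2 < b \<longleftrightarrow> w * k^2 < B"
    by (auto simp: B_def)
  \<comment> \<open>The other root of that quadratic is \<open>- w - 1/2\<close>, which explains the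
    second factor; it is positive for positive \<open>B\<close>.\<close>
  have J: "48 * B^2 + 24 * B * k^2 - 5 * k^4 = 48 * ((B - w * k^2) * (B + w * k^2 + k^2 / 2))"
    using w_eq by algebra
  have wk: "0 < w * k^2" "w * k^2 < k^2 / 4"
    using w k2 by (auto simp: mult_less_cancel_right2[of "w * 4", simplified])
  show ?thesis
  proof (intro conjI impI)
    assume "- (1/2)*C1^2 - C1*C2 < b \<and> b < b1const C1 C2"
    then have B: "0 < B" "B < w * k^2" using b_iff b1_iff by auto
    have "0 < B" "3 * B < k^2" using B wk k2 by linarith+
    then interpret period_curve k B using k by unfold_locales
    have "(B - w * k^2) * (B + w * k^2 + k^2 / 2) < 0"
      by (rule mult_neg_pos) (use B wk k2 in linarith)+
    then have "48 * B^2 + 24 * B * k^2 - 5 * k^4 < 0"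
      unfolding J by linarith
    note L = L_decreasing[OF this]
    show "strict_mono_on (admC3 C1 C2 b) (\<lambda>C3. period C1 C2 C3 b)"
      unfolding admC3_eq[OF k_def B_def]
    proof (rule strict_mono_onI)
      fix x y assume "x \<in> h ` dom" "y \<in> h ` dom" "x < y"
      then obtain s t where st: "s \<in> dom" "t \<in> dom" "x = h s" "y = h t" by blast
      then have "t < s" using \<open>x < y\<close> h_less_iff by simp
      then show "period C1 C2 x b < period C1 C2 y b"
        using st L by (simp add: period_eq[OF k_def B_def])
    qed
  next
    assume "b1const C1 C2 < b \<and> b < (C2^2 - 4*C1*C2)/8"
    then have B: "w * k^2 < B" "4 * B < k^2" using b_iff b1_iff by auto
    have "0 < B" "3 * B < k^2" using B wk k2 by linarith+
    then interpret period_curve k B using k by unfold_locales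
    have T: "0 < T" using B by (simp add: T_def)
    have "0 < 48 * B^2 + 24 * B * k^2 - 5 * k^4"
      unfolding J using B wk k2 by (intro mult_pos_pos) auto
    from L_unimodal[OF T this] obtain s where s: "s \<in> dom"
      "\<And>a b. a \<in> dom \<Longrightarrow> b \<in> dom \<Longrightarrow> a < b \<Longrightarrow> b \<le> s \<Longrightarrow> L a < L b"
      "\<And>a b. a \<in> dom \<Longrightarrow> b \<in> dom \<Longrightarrow> s \<le> a \<Longrightarrow> a < b \<Longrightarrow> L b < L a"
      by blast
    show "\<exists>Cs\<in>admC3 C1 C2 b.
        strict_mono_on (admC3 C1 C2 b \<inter> {..Cs}) (\<lambda>C3. period C1 C2 C3 b) \<and>
        strict_decr_on (admC3 C1 C2 b \<inter> {Cs..}) (\<lambda>C3. period C1 C2 C3 b)"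
      unfolding admC3_eq[OF k_def B_def]
    proof (intro bexI[of _ "h s"] conjI)
      \<comment> \<open>Values of \<open>C3\<close> up to \<open>h s\<close> belong to parameters
        from \<open>s\<close> on, where \<open>L\<close> decreases; since \<open>h\<close> reverses
        the order, the period increases in \<open>C3\<close>.\<close>
      show "strict_mono_on (h ` dom \<inter> {..h s}) (\<lambda>C3. period C1 C2 C3 b)"
      proof (rule strict_mono_onI)
        fix x y assume "x \<in> h ` dom \<inter> {..h s}" "y \<in> h ` dom \<inter> {..h s}" "x < y"
        then obtain u t where "u \<in> dom" "t \<in> dom" "x = h u" "y = h t" "t < u" "s \<le> t"
          using s(1) by (auto simp: h_less_iff h_le_iff)
        then show "period C1 C2 x b < period C1 C2 y b"
          using s(3) by (simp add: period_eq[OF k_def B_def])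
      qed
      show "strict_decr_on (h ` dom \<inter> {h s..}) (\<lambda>C3. period C1 C2 C3 b)"
        unfolding strict_decr_on_def
      proof (intro ballI impI)
        fix x y assume "x \<in> h ` dom \<inter> {h s..}" "y \<in> h ` dom \<inter> {h s..}" "x < y"
        then obtain u t where "u \<in> dom" "t \<in> dom" "x = h u" "y = h t" "t < u" "u \<le> s"
          using s(1) by (auto simp: h_less_iff h_le_iff)
        then show "period C1 C2 y b < period C1 C2 x b"
          using s(2) by (simp add: period_eq[OF k_def B_def])
      qed
    qed (use s in simp)
  next
    assume "(C2^2 - 4*C1*C2)/8 < b \<and> b < (C1 - C2)^2/6"
    then have B: "k^2 < 4 * B" "3 * B < k^2" using b_iff by auto
    interpret period_curve k B by unfold_locales (use k B k2 in auto)
    note L = L_increasing[OF B(1)]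
    show "strict_decr_on (admC3 C1 C2 b) (\<lambda>C3. period C1 C2 C3 b)"
      unfolding strict_decr_on_def admC3_eq[OF k_def B_def]
    proof (intro ballI impI)
      fix x y assume "x \<in> h ` dom" "y \<in> h ` dom" "x < y"
      then obtain s t where st: "s \<in> dom" "t \<in> dom" "x = h s" "y = h t" by blast
      then have "t < s" using \<open>x < y\<close> h_less_iff by simp
      then show "period C1 C2 y b < period C1 C2 x b"
        using st L by (simp add: period_eq[OF k_def B_def])
    qed
  qed
qed

end
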